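(* Let $K$ be an algebraically closed field, $S=K[y_0,\dots,y_n]$, $\mathfrak M=(y_0,\dots,y_n)$, and let $\mathfrak I\subset S$ be a homogeneous ideal with $\mathfrak I^{sat}\subsetneq\mathfrak M$. For each degree $d$ let $\nu_e(d)$ (respectively $\mu_e(d)$) be the greatest (respectively smallest) number of essential elements of degree $d$ contained in a standard basis of $\mathfrak I$. Then there exists a standard basis $\mathcal B_{Max}(\mathfrak I)$ of $\mathfrak I$ having, in every degree $d$, exactly $\nu_e(d)$ essential elements, and there exists a standard basis $\mathcal B_{min}(\mathfrak I)$ of $\mathfrak I$ having, in every degree $d$, exactly $\mu_e(d)$ essential elements.
   Context: For a homogeneous ideal $\mathfrak I$, $\mathfrak I^{sat}=\{f\in S:\ f\,\mathfrak M^t\subseteq\mathfrak I\text{ for some }t\in\mathbb N\}$. A standard basis of $\mathfrak I$ is an ordered set of forms generating $\mathfrak I$ such that, for each $d$, its elements of degree $d$ define a $K$-basis of $\mathfrak I_d/(\mathfrak I_{d-1}S_1)$. An element $f$ of a standard basis $\mathcal B$ is inessential with respect to $\mathcal B$ if $f\in\mathfrak H^{sat}$, where $\mathfrak H$ is the ideal generated by $\mathcal B\setminus\{f\}$; otherwise it is essential with respect to $\mathcal B$. The number of essential elements of a standard basis is counted with respect to that basis. *)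

theory Defs
  imports
    "HOL-Library.Poly_Mapping"
    "HOL-Computational_Algebra.Polynomial"
begin

section \<open>The polynomial ring\<close>

text \<open>
  For a finite (hence nonempty) type \<open>'v\<close> of variables, \<open>('v, 'k) mpol\<close> is the polynomial ring
  $K[y_0,\dots,y_n]$ with $n + 1$ the cardinality of \<open>'v\<close>: a polynomial is the finitely
  supported map from monomials (exponent vectors) to coefficients, and the product of
  \<^theory>\<open>HOL-Library.Poly_Mapping\<close> is the convolution product.
\<close>

type_synonym ('v, 'k) mpol = "('v \<Rightarrow>\<^sub>0 nat) \<Rightarrow>\<^sub>0 'k"

definition var :: "'v \<Rightarrow> ('v, 'k::field) mpol"
  where "var v = Poly_Mapping.single (Poly_Mapping.single v 1) 1"

definition kscale :: "'k::field \<Rightarrow> ('v, 'k) mpol \<Rightarrow> ('v, 'k) mpol"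
  where "kscale c f = Poly_Mapping.single 0 c * f"

lemma vector_space_kscale: "vector_space (kscale :: 'k::field \<Rightarrow> ('v, 'k) mpol \<Rightarrow> _)"
  by unfold_locales
    (simp_all add: kscale_def algebra_simps single_add mult_single flip: mult.assoc)

abbreviation kspan :: "('v, 'k::field) mpol set \<Rightarrow> ('v, 'k) mpol set"
  where "kspan \<equiv> module.span kscale"

definition mon_deg :: "('v::finite \<Rightarrow>\<^sub>0 nat) \<Rightarrow> nat"
  where "mon_deg m = (\<Sum>v\<in>UNIV. Poly_Mapping.lookup m v)"

text \<open>The graded piece $S_d$; it contains \<open>0\<close>.\<close>

definition forms :: "nat \<Rightarrow> ('v::finite, 'k::field) mpol set"
  where "forms d = {f. \<forall>m \<in> Poly_Mapping.keys f. mon_deg m = d}"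


section \<open>Ideals\<close>

text \<open>An ideal is a submodule of the ring regarded as a module over itself.\<close>

lemma module_mult: "module ((*) :: 'a::comm_ring_1 \<Rightarrow> 'a \<Rightarrow> 'a)"
  by unfold_locales (simp_all add: algebra_simps)

abbreviation is_ideal :: "'a::comm_ring_1 set \<Rightarrow> bool"
  where "is_ideal \<equiv> module.subspace (*)"

abbreviation ideal_of :: "'a::comm_ring_1 set \<Rightarrow> 'a set"
  where "ideal_of \<equiv> module.span (*)"

primrec ideal_pow :: "'a::comm_ring_1 set \<Rightarrow> nat \<Rightarrow> 'a set"
  where
    "ideal_pow A 0 = UNIV"
  | "ideal_pow A (Suc t) = ideal_of {a * b | a b. a \<in> A \<and> b \<in> ideal_pow A t}"

definition homogeneous_ideal :: "('v::finite, 'k::field) mpol set \<Rightarrow> bool"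
  where "homogeneous_ideal I \<longleftrightarrow>
    is_ideal I \<and> (\<exists>G. G \<subseteq> (\<Union>d. forms d) \<and> I = ideal_of G)"

definition max_ideal :: "('v, 'k::field) mpol set"
  where "max_ideal = ideal_of (range var)"

definition sat :: "('v, 'k::field) mpol set \<Rightarrow> ('v, 'k) mpol set"
  where "sat I = {f. \<exists>t. \<forall>g \<in> ideal_pow max_ideal t. f * g \<in> I}"


section \<open>Standard bases and their essential elements\<close>

text \<open>
  The $K$-space $\mathfrak I_{d-1}S_1$. For \<open>d = 0\<close> the set of products is empty, so this is the
  zero space, in accordance with $\mathfrak I_{-1} = 0$.
\<close>

definition from_below :: "('v::finite, 'k::field) mpol set \<Rightarrow> nat \<Rightarrow> ('v, 'k) mpol set"
  where "from_below I d =
    kspan {f * l | f l e. Suc e = d \<and> f \<in> I \<inter> forms e \<and> l \<in> forms 1}"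

text \<open>
  The classes of the elements of \<open>D\<close> form a $K$-basis of the quotient space \<open>V / W\<close>. The
  second clause says that the family of classes is linearly independent; in particular distinct
  elements of \<open>D\<close> have distinct classes, and \<open>0 \<notin> D\<close>.
\<close>

definition quotient_basis ::
  "('v, 'k::field) mpol set \<Rightarrow> ('v, 'k) mpol set \<Rightarrow> ('v, 'k) mpol set \<Rightarrow> bool"
  where "quotient_basis D V W \<longleftrightarrow>
    D \<subseteq> V \<and>
    (\<forall>F c. finite F \<and> F \<subseteq> D \<and> (\<Sum>f\<in>F. kscale (c f) f) \<in> W \<longrightarrow> (\<forall>f\<in>F. c f = 0)) \<and>
    (\<forall>g\<in>V. \<exists>F c. finite F \<and> F \<subseteq> D \<and> g - (\<Sum>f\<in>F. kscale (c f) f) \<in> W)"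

text \<open>
  A standard basis is an ordered set, encoded as its underlying set \<open>B\<close> with a linear order \<open>r\<close>
  on it. The remaining notions do not depend on \<open>r\<close>.
\<close>

definition standard_basis ::
  "('v::finite, 'k::field) mpol set \<Rightarrow> ('v, 'k) mpol set \<Rightarrow> ('v, 'k) mpol rel \<Rightarrow> bool"
  where "standard_basis I B r \<longleftrightarrow>
    linear_order_on B r \<and>
    B \<subseteq> (\<Union>d. forms d) \<and>
    ideal_of B = I \<and>
    (\<forall>d. quotient_basis (B \<inter> forms d) (I \<inter> forms d) (from_below I d))"

definition inessential :: "('v, 'k::field) mpol set \<Rightarrow> ('v, 'k) mpol \<Rightarrow> bool"
  where "inessential B f \<longleftrightarrow> f \<in> B \<and> f \<in> sat (ideal_of (B - {f}))"

definition essential :: "('v, 'k::field) mpol set \<Rightarrow> ('v, 'k) mpol \<Rightarrow> bool"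
  where "essential B f \<longleftrightarrow> f \<in> B \<and> \<not> inessential B f"

text \<open>
  For a standard basis \<open>B\<close> the set counted here is finite, being linearly independent in the
  finite-dimensional space \<open>forms d\<close>; so the cardinality is the true number of elements, and the
  numbers of essential elements of degree \<open>d\<close> of the standard bases of \<open>I\<close> are bounded.
\<close>

definition num_essential :: "('v::finite, 'k::field) mpol set \<Rightarrow> nat \<Rightarrow> nat"
  where "num_essential B d = card {f \<in> forms d. essential B f}"

definition nu_e :: "('v::finite, 'k::field) mpol set \<Rightarrow> nat \<Rightarrow> nat"
  where "nu_e I d = (GREATEST k. \<exists>B r. standard_basis I B r \<and> num_essential B d = k)"

definition mu_e :: "('v::finite, 'k::field) mpol set \<Rightarrow> nat \<Rightarrow> nat"
  where "mu_e I d = (LEAST k. \<exists>B r. standard_basis I B r \<and> num_essential B d = k)"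

end

theory Submission
  imports
    Defs
    "HOL-Library.Infinite_Set"
    "HOL-Computational_Algebra.Primes"
begin

text \<open>
  Write \<open>I\<^sub>d\<close> for the forms of degree \<open>d\<close> in \<open>I\<close>. A standard basis amounts to choosing, in each
  degree \<open>d\<close> independently, a lift to \<open>I\<^sub>d\<close> of a basis of \<open>I\<^sub>d / I\<^sub>d\<^sub>-\<^sub>1 S\<^sub>1\<close>. The obstacle is that
  whether an element of degree \<open>d\<close> is essential depends also on the choices made in higher degrees,
  so bases that are optimal in different degrees have to be reconciled.

  To have as many essential elements as possible in every degree, take for each \<open>d\<close> a standard basis
  \<open>B\<^sub>d\<close> that is optimal in degree \<open>d\<close>. For an essential \<open>f \<in> B\<^sub>d\<close> of degree \<open>d\<close> let \<open>H\<^sub>f\<close> be the ideal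
  generated by \<open>B\<^sub>d - {f}\<close>. It contains all forms of \<open>I\<close> of degree \<open>< d\<close>, hence \<open>I\<^sub>d\<^sub>-\<^sub>1 S\<^sub>1\<close>, and
  \<open>I = H\<^sub>f + (f)\<close>. So every \<open>b \<in> I\<^sub>e\<close> with \<open>e > d\<close> can be moved into \<open>H\<^sub>f\<close> by subtracting a multiple of
  \<open>f\<close>, which does not change the class of \<open>b\<close> modulo \<open>I\<^sub>e\<^sub>-\<^sub>1 S\<^sub>1\<close>. Collecting the degree \<open>d\<close> parts of
  all the \<open>B\<^sub>d\<close> and making these corrections for all smaller degrees at once, by recursion on the
  degree, gives a standard basis in which every (corrected) \<open>f\<close> has all the other elements in \<open>H\<^sub>f\<close>.
  As \<open>f\<close> is not in the saturation of \<open>H\<^sub>f\<close>, it is still essential: see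
  \<open>simultaneous_essential_basis\<close>.

  For the smallest numbers, the point is that being inessential is an open condition. All standard
  bases have the same number of elements in each degree, so they can be indexed by a fixed set. The
  element with a given index, of degree \<open>d\<close>, is inessential iff for some \<open>t\<close> the products of degree
  \<open>d + t\<close> of monomials with the other elements span \<open>I\<^sub>d\<^sub>+\<^sub>t\<close> (\<open>redundant_iff_spanning\<close>). Along the line
  joining two indexed standard bases, a spanning condition that holds at one end fails for finitely many
  parameters only (\<open>finite_nonspanning_pencil\<close>), and being a standard basis is itself such a condition
  in each of the finitely many degrees in which \<open>I\<close> needs generators (\<open>eventually_from_below\<close>). An
  algebraically closed field is infinite, so the elements with indices in a finite set can be made
  inessential together if each of them is inessential in some standard basis
  (\<open>simultaneously_redundant\<close>). Apply this to the indices of degree \<open>d\<close> that are inessential in a basis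
  minimal in degree \<open>d\<close>, for all \<open>d\<close>.
\<close>

section \<open>Spanning families on a line\<close>

context vector_space
begin

lemma independent_card_spans:
  assumes "independent A" "A \<subseteq> span B" "finite B" "card B \<le> card A"
  shows "span B \<subseteq> span A"
proof
  fix v assume v: "v \<in> span B"
  have fin: "finite A" and le: "card A \<le> card B"
    using independent_span_bound[OF assms(3,1,2)] by auto
  show "v \<in> span A"
  proof (rule ccontr)
    assume nv: "v \<notin> span A"
    then have "independent (insert v A)"
      using assms(1) independent_insertI by blast
    then have "card (insert v A) \<le> card B"
      using independent_span_bound[OF assms(3), of "insert v A"] v assms(2) by auto
    moreover have "v \<notin> A" using nv span_base by blast
    ultimately show False using fin assms(4) by simp
  qed
qed

text \<open>
  Eigenvectors for distinct eigenvalues are independent: applying \<open>T - a\<close> to the relation removes the term of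
  the eigenvalue \<open>a\<close> and multiplies the others by nonzero scalars.
\<close>

lemma eigenvectors_sum_zero:
  assumes T: "Vector_Spaces.linear scale scale T"
    and "finite M" "\<And>m. m \<in> M \<Longrightarrow> T (x m) = scale m (x m)" "(\<Sum>m\<in>M. x m) = 0"
  shows "\<forall>m\<in>M. x m = 0"
  using assms(2-)
proof (induction M arbitrary: x rule: finite_induct)
  case (insert a M)
  interpret T: Vector_Spaces.linear scale scale T by (rule T)
  have "0 = T (\<Sum>m\<in>insert a M. x m) - scale a (\<Sum>m\<in>insert a M. x m)"
    using insert.prems(2) by (simp add: T.zero)
  also have "\<dots> = (\<Sum>m\<in>insert a M. scale (m - a) (x m))"
    unfolding T.sum scale_sum_right sum_subtractf[symmetric]
    by (intro sum.cong refl) (simp only: insert.prems(1) scale_left_diff_distrib)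
  also have "\<dots> = (\<Sum>m\<in>M. scale (m - a) (x m))"
    using insert.hyps by simp
  finally have "\<forall>m\<in>M. scale (m - a) (x m) = 0"
    by (intro insert.IH) (simp_all add: T.scale insert.prems(1) mult.commute)
  then have "\<forall>m\<in>M. x m = 0"
    using insert.hyps by auto
  then show ?case using insert.prems(2) insert.hyps by simp
qed simp

lemma finite_eigenvalues:
  assumes T: "Vector_Spaces.linear scale scale T" and "finite S"
  shows "finite {m. \<exists>x\<in>span S. x \<noteq> 0 \<and> T x = scale m x}" (is "finite ?E")
proof -
  obtain x where x: "\<And>m. m \<in> ?E \<Longrightarrow> x m \<in> span S \<and> x m \<noteq> 0 \<and> T (x m) = scale m (x m)"
    by (atomize_elim, intro choice) blast
  interpret T: Vector_Spaces.linear scale scale T by (rule T)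
  have inj: "inj_on x ?E"
  proof (rule inj_onI)
    fix m n assume mn: "m \<in> ?E" "n \<in> ?E" "x m = x n"
    then have "scale m (x m) = scale n (x m)" using x[of m] x[of n] by metis
    then show "m = n" using x[OF mn(1)] by simp
  qed
  have "independent (x ` ?E)"
    unfolding independent_explicit_finite_subsets
  proof (intro allI impI)
    fix A u assume A: "A \<subseteq> x ` ?E" "finite A" "(\<Sum>v\<in>A. scale (u v) v) = 0"
    obtain M where M: "M \<subseteq> ?E" "A = x ` M" "finite M"
      using A by (meson finite_subset_image)
    have injM: "inj_on x M" using inj M(1) inj_on_subset by blast
    have "\<forall>m\<in>M. scale (u (x m)) (x m) = 0"
    proof (rule eigenvectors_sum_zero[OF T M(3)])
      fix m assume "m \<in> M"
      then show "T (scale (u (x m)) (x m)) = scale m (scale (u (x m)) (x m))"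
        using x M(1) T.scale by (auto simp: mult.commute subset_iff)
    next
      show "(\<Sum>m\<in>M. scale (u (x m)) (x m)) = 0"
        using A(3) injM M(2) by (simp add: sum.reindex)
    qed
    then show "\<forall>v\<in>A. u v = 0"
      using M x by (auto simp: subset_iff)
  qed
  then have "finite (x ` ?E)"
    using independent_span_bound[OF \<open>finite S\<close>] x by blast
  then show ?thesis using inj finite_imageD by blast
qed

text \<open>
  A weak form of openness of the spanning condition. Pick a basis \<open>B\<close> of \<open>V\<close> among the \<open>u j\<close>, and let \<open>T\<close> be
  the endomorphism sending each of them to the corresponding \<open>w j\<close>. The family with parameter \<open>c\<close> contains the
  image of \<open>B\<close> under \<open>1 + c T\<close>, which spans \<open>V\<close> unless \<open>1 + c T\<close> has a kernel on \<open>V\<close>, that is, unless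
  \<open>-1/c\<close> is one of the finitely many eigenvalues of \<open>T\<close>.
\<close>

lemma finite_nonspanning_pencil:
  assumes "finite J" and V: "subspace V"
    and u: "\<And>j. j \<in> J \<Longrightarrow> u j \<in> V" and w: "\<And>j. j \<in> J \<Longrightarrow> w j \<in> V"
    and span: "V \<subseteq> span (u ` J)"
  shows "finite {c. \<not> V \<subseteq> span ((\<lambda>j. u j + scale c (w j)) ` J)}" (is "finite ?bad")
proof -
  interpret endo: vector_space_pair scale scale by unfold_locales
  obtain B where B: "B \<subseteq> u ` J" "independent B" "u ` J \<subseteq> span B"
    by (rule maximal_independent_subset)
  have finB: "finite B" using B(1) \<open>finite J\<close> finite_surj by blast
  have V_eq: "V = span B"
  proof
    show "V \<subseteq> span B" using span span_minimal[OF B(3)] by blast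
    show "span B \<subseteq> V" using B(1) u V by (intro span_minimal) auto
  qed
  obtain p where p: "\<And>b. b \<in> B \<Longrightarrow> p b \<in> J \<and> u (p b) = b"
  proof -
    have "\<forall>b. \<exists>j. b \<in> B \<longrightarrow> j \<in> J \<and> u j = b" using B(1) by blast
    then show ?thesis using that by metis
  qed
  obtain T where T: "Vector_Spaces.linear scale scale T" and Tb: "\<And>b. b \<in> B \<Longrightarrow> T b = w (p b)"
    using endo.linear_independent_extend[OF B(2), of "\<lambda>b. w (p b)"] by blast
  interpret T: Vector_Spaces.linear scale scale T by (rule T)
  have TV: "T x \<in> V" if "x \<in> V" for x
    using that unfolding V_eq
  proof (induction rule: span_induct_alt)
    case (step c b y)
    then show ?case
      using Tb p w V unfolding V_eq by (metis T.add T.scale subspace_add subspace_scale)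
  qed (simp add: T.zero span_zero)
  have "?bad \<subseteq> (\<lambda>m. - inverse m) ` {m. \<exists>x\<in>span B. x \<noteq> 0 \<and> T x = scale m x}"
  proof
    fix c assume c: "c \<in> ?bad"
    define R where "R x = x + scale c (T x)" for x
    have R: "Vector_Spaces.linear scale scale R"
      unfolding R_def linear_iff_module_hom
      by unfold_locales (simp_all add: T.add T.scale algebra_simps)
    interpret R: Vector_Spaces.linear scale scale R by (rule R)
    have RB: "R ` B \<subseteq> (\<lambda>j. u j + scale c (w j)) ` J"
      using p Tb unfolding R_def by force
    have "\<not> inj_on R (span B)"
    proof
      assume inj: "inj_on R (span B)"
      have "independent (R ` B)"
        using endo.linear_independent_injective_image[OF R B(2) inj] by blast
      moreover have "R ` B \<subseteq> span B"
      proof (intro image_subsetI)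
        fix b assume "b \<in> B"
        then have "b \<in> V" using V_eq span_base by blast
        then show "R b \<in> span B"
          using TV V subspace_add subspace_scale unfolding R_def V_eq[symmetric] by blast
      qed
      moreover have "card B \<le> card (R ` B)"
        using inj by (metis card_image inj_on_subset le_refl span_superset)
      ultimately have "span B \<subseteq> span (R ` B)"
        using independent_card_spans finB by blast
      also have "\<dots> \<subseteq> span ((\<lambda>j. u j + scale c (w j)) ` J)"
        using RB by (rule span_mono)
      finally show False using c V_eq by blast
    qed
    then obtain x where x: "x \<in> span B" "x \<noteq> 0" "R x = 0"
      using R.inj_on_iff_eq_0[OF subspace_span] by blast
    have c0: "c \<noteq> 0" using x unfolding R_def by auto
    have "scale c (T x) = - x" using x(3) unfolding R_def by (metis add.commute add_eq_0_iff)
    then have "scale (inverse c) (scale c (T x)) = scale (- inverse c) x" by simp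
    then have "T x = scale (- inverse c) x" using c0 by simp
    then show "c \<in> (\<lambda>m. - inverse m) ` {m. \<exists>x\<in>span B. x \<noteq> 0 \<and> T x = scale m x}"
      using x c0 by (intro image_eqI[of _ _ "- inverse c"]) auto
  qed
  then show ?thesis
    using finite_eigenvalues[OF T finB] finite_subset by blast
qed

end

section \<open>Bases of quotient spaces\<close>

interpretation vs: vector_space kscale
  by (rule vector_space_kscale)

interpretation ideal: module "(*)"
  by (rule module_mult)

lemma quotient_basisD:
  assumes "quotient_basis D V W"
  shows "D \<subseteq> V"
    and "\<lbrakk>finite F; F \<subseteq> D; (\<Sum>f\<in>F. kscale (c f) f) \<in> W; f \<in> F\<rbrakk> \<Longrightarrow> c f = 0"
    and "g \<in> V \<Longrightarrow> \<exists>F c. finite F \<and> F \<subseteq> D \<and> g - (\<Sum>f\<in>F. kscale (c f) f) \<in> W"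
  using assms unfolding quotient_basis_def by simp_all

text \<open>
  Adding a basis of \<open>W\<close> turns statements about bases of \<open>V / W\<close> into statements about bases of \<open>V\<close>.
\<close>

lemma quotient_basis_iff:
  assumes W: "vs.independent C" "vs.span C = W" and V: "vs.subspace V"
  shows "quotient_basis D V W \<longleftrightarrow>
    D \<subseteq> V \<and> D \<inter> C = {} \<and> vs.independent (D \<union> C) \<and> V \<subseteq> vs.span (D \<union> C)" (is "?L \<longleftrightarrow> ?R")
proof
  assume L: ?L
  note ind = quotient_basisD(2)[OF L]
  have "D \<inter> C = {}"
  proof (rule ccontr)
    assume "D \<inter> C \<noteq> {}"
    then obtain f where "f \<in> D" "f \<in> C" by blast
    then show False using ind[of "{f}" "\<lambda>_. 1" f] W(2) vs.span_base by force
  qed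
  moreover have "vs.independent (D \<union> C)"
    unfolding vs.independent_explicit_finite_subsets
  proof (intro allI impI)
    fix S u assume S: "S \<subseteq> D \<union> C" "finite S" "(\<Sum>v\<in>S. kscale (u v) v) = 0"
    have eq: "(\<Sum>v\<in>S \<inter> D. kscale (u v) v) + (\<Sum>v\<in>S - D. kscale (u v) v) = 0"
      using S(3) sum.Int_Diff[OF S(2), of "\<lambda>v. kscale (u v) v" D] by simp
    have "(\<Sum>v\<in>S - D. kscale (u v) v) \<in> W"
      unfolding W(2)[symmetric] using S(1)
      by (intro vs.span_sum vs.span_scale vs.span_base) auto
    then have "(\<Sum>v\<in>S \<inter> D. kscale (u v) v) \<in> W"
      using eq W(2) vs.span_neg[of "\<Sum>v\<in>S - D. kscale (u v) v" C]
      by (simp add: eq_neg_iff_add_eq_0[symmetric])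
    then have D0: "\<And>v. v \<in> S \<inter> D \<Longrightarrow> u v = 0"
      using ind[of "S \<inter> D" u] S(2) by auto
    then have "(\<Sum>v\<in>S - D. kscale (u v) v) = 0"
      using eq by (simp add: sum.neutral)
    then have "u v = 0" if "v \<in> S - D" for v
      using that S by (intro vs.independentD[OF W(1), of "S - D" u]) auto
    then show "\<forall>v\<in>S. u v = 0" using D0 by blast
  qed
  moreover have "V \<subseteq> vs.span (D \<union> C)"
  proof
    fix g assume "g \<in> V"
    then obtain F c where F: "finite F" "F \<subseteq> D" "g - (\<Sum>f\<in>F. kscale (c f) f) \<in> W"
      using quotient_basisD(3)[OF L] by blast
    have "g - (\<Sum>f\<in>F. kscale (c f) f) \<in> vs.span (D \<union> C)"
      using F(3) vs.span_mono[of C "D \<union> C"] unfolding W(2) by auto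
    moreover have "(\<Sum>f\<in>F. kscale (c f) f) \<in> vs.span (D \<union> C)"
      using F(2) by (intro vs.span_sum vs.span_scale vs.span_base) auto
    ultimately show "g \<in> vs.span (D \<union> C)"
      using vs.span_add[of "g - (\<Sum>f\<in>F. kscale (c f) f)" "D \<union> C" "\<Sum>f\<in>F. kscale (c f) f"]
      by simp
  qed
  ultimately show ?R using quotient_basisD(1)[OF L] by blast
next
  assume R: ?R
  have "c f = 0" if F: "finite F" "F \<subseteq> D" "(\<Sum>f\<in>F. kscale (c f) f) \<in> W" "f \<in> F" for F c f
  proof -
    obtain S u where S: "finite S" "S \<subseteq> C" "(\<Sum>f\<in>F. kscale (c f) f) = (\<Sum>v\<in>S. kscale (u v) v)"
      using F(3) unfolding W(2)[symmetric] vs.span_explicit by blast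
    have disj: "F \<inter> S = {}" using R F(2) S(2) by blast
    define e where "e v = (if v \<in> F then c v else - u v)" for v
    have "(\<Sum>v\<in>F \<union> S. kscale (e v) v) = (\<Sum>v\<in>F. kscale (e v) v) + (\<Sum>v\<in>S. kscale (e v) v)"
      using F(1) S(1) disj by (rule sum.union_disjoint)
    also have "(\<Sum>v\<in>F. kscale (e v) v) = (\<Sum>v\<in>F. kscale (c v) v)"
      unfolding e_def by (intro sum.cong) auto
    also have "(\<Sum>v\<in>S. kscale (e v) v) = - (\<Sum>v\<in>S. kscale (u v) v)"
      unfolding e_def sum_negf[symmetric] using disj by (intro sum.cong) auto
    finally have "(\<Sum>v\<in>F \<union> S. kscale (e v) v) = 0" using S(3) by simp
    then have "e f = 0"
      using vs.independentD[of "D \<union> C" "F \<union> S" e f] R F S by blast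
    then show ?thesis using F(4) unfolding e_def by simp
  qed
  moreover have "\<exists>F c. finite F \<and> F \<subseteq> D \<and> g - (\<Sum>f\<in>F. kscale (c f) f) \<in> W" if "g \<in> V" for g
  proof -
    have "g \<in> vs.span (D \<union> C)" using that R by blast
    then obtain x y where xy: "g = x + y" "x \<in> vs.span D" "y \<in> vs.span C"
      unfolding vs.span_Un by blast
    obtain F c where "finite F" "F \<subseteq> D" "x = (\<Sum>f\<in>F. kscale (c f) f)"
      using xy(2) unfolding vs.span_explicit by blast
    then show ?thesis using xy W(2) by (intro exI[of _ F] exI[of _ c]) auto
  qed
  ultimately show ?L using R unfolding quotient_basis_def by blast
qed

lemma quotient_basis_exists:
  assumes "vs.subspace W" "vs.subspace V" "W \<subseteq> V"
  shows "\<exists>D. quotient_basis D V W"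
proof -
  obtain C where C: "C \<subseteq> W" "vs.independent C" "W \<subseteq> vs.span C"
    by (rule vs.maximal_independent_subset)
  have sC: "vs.span C = W" using C assms(1) by (simp add: vs.span_subspace)
  obtain B where B: "C \<subseteq> B" "B \<subseteq> V" "vs.independent B" "V \<subseteq> vs.span B"
    using vs.maximal_independent_subset_extend[of C V] C assms(3) by blast
  have "(B - C) \<union> C = B" using B(1) by blast
  then have "quotient_basis (B - C) V W"
    unfolding quotient_basis_iff[OF C(2) sC assms(2)] using B by auto
  then show ?thesis by blast
qed

lemma quotient_basis_card:
  assumes "quotient_basis D V W" "vs.subspace W" "vs.subspace V" "W \<subseteq> V" "finite S" "V \<subseteq> vs.span S"
  shows "finite D" "card D + vs.dim W = vs.dim V"
proof -
  obtain C where C: "C \<subseteq> W" "vs.independent C" "W \<subseteq> vs.span C"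
    by (rule vs.maximal_independent_subset)
  have sC: "vs.span C = W" using C assms(2) by (simp add: vs.span_subspace)
  have DC: "D \<subseteq> V" "D \<inter> C = {}" "vs.independent (D \<union> C)" "V \<subseteq> vs.span (D \<union> C)"
    using assms(1) unfolding quotient_basis_iff[OF C(2) sC assms(3)] by auto
  have "finite (D \<union> C)"
    using vs.independent_span_bound[OF assms(5) DC(3)] DC(1) C(1) assms(4,6) by blast
  then have fin: "finite D" "finite C" by auto
  then show "finite D" by simp
  have "vs.span (D \<union> C) = vs.span V"
    using vs.span_subspace[OF _ DC(4) assms(3)] DC(1) order_trans[OF C(1) assms(4)]
      vs.span_span[of "D \<union> C"] by (metis Un_least)
  then have "vs.dim V = card (D \<union> C)"
    using vs.dim_eq_card[of "D \<union> C" V] DC(3) by auto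
  moreover have "vs.dim W = card C"
    using vs.dim_eq_card[of C W] C(2) sC vs.span_span by metis
  ultimately show "card D + vs.dim W = vs.dim V"
    using fin DC(2) by (simp add: card_Un_disjoint)
qed

text \<open>
  When the number of vectors is the dimension of \<open>V / W\<close>, spanning is enough. This makes being a lifted basis a
  spanning condition, to which \<open>finite_nonspanning_pencil\<close> applies.
\<close>

lemma quotient_basis_spanningI:
  assumes "vs.subspace W" "vs.subspace V" "W \<subseteq> V" "finite S" "V \<subseteq> vs.span S"
    and g: "\<And>i. i < r \<Longrightarrow> g i \<in> V" and V: "V \<subseteq> vs.span (g ` {..<r} \<union> W)"
    and r: "r + vs.dim W = vs.dim V"
  shows "quotient_basis (g ` {..<r}) V W" "inj_on g {..<r}"
proof -
  obtain C where C: "C \<subseteq> W" "vs.independent C" "W \<subseteq> vs.span C"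
    by (rule vs.maximal_independent_subset)
  have sC: "vs.span C = W" using C assms(1) by (simp add: vs.span_subspace)
  obtain B where B: "B \<subseteq> V" "vs.independent B" "V \<subseteq> vs.span B"
    by (rule vs.maximal_independent_subset)
  have dimC: "vs.dim W = card C"
    using vs.dim_eq_card[of C W] C(2) sC vs.span_span by metis
  have "vs.dim V = card B"
    using vs.dim_eq_card[OF _ B(2), of V] vs.span_subspace[OF B(1,3) assms(2)]
    by (metis vs.span_span)
  then have cardB: "card B = r + card C" using r dimC by simp
  have finC: "finite C"
    using vs.independent_span_bound[OF assms(4) C(2)] C(1) assms(3,5) by (meson order_trans)
  define G where "G = g ` {..<r} \<union> C"
  have finG: "finite G" unfolding G_def using finC by simp
  have "W \<subseteq> vs.span G"
    unfolding sC[symmetric] G_def by (intro vs.span_mono) auto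
  then have VG: "V \<subseteq> vs.span G"
  proof -
    have "g ` {..<r} \<union> W \<subseteq> vs.span G"
      using \<open>W \<subseteq> vs.span G\<close> vs.span_superset[of G] unfolding G_def by auto
    then show ?thesis using V vs.span_minimal[OF _ vs.subspace_span] by blast
  qed
  have bB: "card B \<le> card G"
    using vs.independent_span_bound[OF finG B(2) order_trans[OF B(1) VG]] by simp
  have cg: "card (g ` {..<r}) \<le> r" using card_image_le[of "{..<r}" g] by simp
  have "card G + card (g ` {..<r} \<inter> C) = card (g ` {..<r}) + card C"
    unfolding G_def using card_Un_Int[of "g ` {..<r}" C] finC by simp
  then have "card (g ` {..<r}) = r" and disj: "card (g ` {..<r} \<inter> C) = 0"
    and cG: "card G = card B"
    using bB cg cardB by linarith+
  then show inj: "inj_on g {..<r}" by (simp add: eq_card_imp_inj_on)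
  have disj: "g ` {..<r} \<inter> C = {}" using disj finC by simp
  have GV: "G \<subseteq> V" unfolding G_def using g C(1) assms(3) by auto
  have "vs.independent G"
  proof -
    obtain A where A: "A \<subseteq> G" "vs.independent A" "G \<subseteq> vs.span A"
      by (rule vs.maximal_independent_subset)
    have "finite A" using A(1) finG finite_subset by blast
    moreover have "B \<subseteq> vs.span A"
      using B(1) VG vs.span_minimal[OF A(3)] by blast
    ultimately have "card G \<le> card A"
      using vs.independent_span_bound[OF _ B(2)] cG by metis
    then have "A = G" using A(1) finG card_seteq by blast
    then show ?thesis using A(2) by simp
  qed
  then show "quotient_basis (g ` {..<r}) V W"
    unfolding quotient_basis_iff[OF C(2) sC assms(2)]
    using g disj VG unfolding G_def by auto
qed

text \<open>
  Only the classes modulo \<open>W\<close> matter. Injectivity of \<open>h\<close> comes with it, because distinct elements of \<open>D\<close> have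
  distinct classes and \<open>h\<close> preserves classes.
\<close>

lemma quotient_basis_perturb:
  assumes D: "quotient_basis D V W" and W: "vs.subspace W" "W \<subseteq> V" "vs.subspace V"
    and h: "\<And>b. b \<in> D \<Longrightarrow> h b - b \<in> W"
  shows "quotient_basis (h ` D) V W" "inj_on h D"
proof -
  note ind = quotient_basisD(2)[OF D]
  note DV = quotient_basisD(1)[OF D]
  show inj: "inj_on h D"
  proof (rule inj_onI, rule ccontr)
    fix a b assume ab: "a \<in> D" "b \<in> D" "h a = h b" "a \<noteq> b"
    have "(h b - b) - (h a - a) \<in> W"
      using h ab W(1) vs.subspace_diff by blast
    then have "a - b \<in> W" using ab(3) by simp
    moreover have "(\<Sum>f\<in>{a,b}. kscale (if f = a then 1 else -1) f) = a - b"
      using ab(4) by simp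
    ultimately have "(if a = a then 1 else -1 :: 'b) = 0"
      using ind[of "{a,b}" "\<lambda>f. if f = a then 1 else -1" a] ab by auto
    then show False by simp
  qed
  have diff: "(\<Sum>f\<in>F. kscale (c f) (h f)) - (\<Sum>f\<in>F. kscale (c f) f) \<in> W" if "F \<subseteq> D" for F c
  proof -
    have "(\<Sum>f\<in>F. kscale (c f) (h f - f)) \<in> W"
      using that h W(1) by (intro vs.subspace_sum vs.subspace_scale) auto
    then show ?thesis by (simp add: vs.scale_right_diff_distrib sum_subtractf)
  qed
  show "quotient_basis (h ` D) V W"
    unfolding quotient_basis_def
  proof (intro conjI allI impI ballI)
    show "h ` D \<subseteq> V"
    proof (intro image_subsetI)
      fix b assume "b \<in> D"
      then show "h b \<in> V" using h[of b] DV W(2,3) vs.subspace_add[of V "h b - b" b] by auto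
    qed
  next
    fix F c f assume F: "finite F \<and> F \<subseteq> h ` D \<and> (\<Sum>f\<in>F. kscale (c f) f) \<in> W" and f: "f \<in> F"
    obtain G where G: "G \<subseteq> D" "finite G" "F = h ` G" using F by (meson finite_subset_image)
    have "(\<Sum>f\<in>F. kscale (c f) f) = (\<Sum>g\<in>G. kscale (c (h g)) (h g))"
      using G inj by (simp add: sum.reindex inj_on_subset)
    then have "(\<Sum>g\<in>G. kscale (c (h g)) g) \<in> W"
      using F vs.subspace_diff[OF W(1) _ diff[OF G(1), of "\<lambda>g. c (h g)"]] by fastforce
    then show "c f = 0" using ind[of G "\<lambda>g. c (h g)"] G f by auto
  next
    fix g assume "g \<in> V"
    then obtain F c where F: "finite F" "F \<subseteq> D" "g - (\<Sum>f\<in>F. kscale (c f) f) \<in> W"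
      using quotient_basisD(3)[OF D] by blast
    have inF: "inj_on h F" using inj F(2) inj_on_subset by blast
    define c' where "c' = c \<circ> the_inv_into F h"
    have "(\<Sum>f\<in>h ` F. kscale (c' f) f) = (\<Sum>f\<in>F. kscale (c f) (h f))"
      using inF by (simp add: sum.reindex c'_def the_inv_into_f_f)
    moreover have "g - (\<Sum>f\<in>F. kscale (c f) (h f)) \<in> W"
      using vs.subspace_diff[OF W(1) F(3) diff[OF F(2), of c]] by simp
    ultimately show "\<exists>F c. finite F \<and> F \<subseteq> h ` D \<and> g - (\<Sum>f\<in>F. kscale (c f) f) \<in> W"
      using F by (intro exI[of _ "h ` F"] exI[of _ c']) auto
  qed
qed

section \<open>Graded pieces, homogeneous ideals and saturation\<close>

abbreviation monomial :: "('v \<Rightarrow>\<^sub>0 nat) \<Rightarrow> ('v, 'k::field) mpol"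
  where "monomial m \<equiv> Poly_Mapping.single m 1"

lemma mon_deg_simps [simp]:
  "mon_deg 0 = 0" "mon_deg (a + b) = mon_deg a + mon_deg b"
  "mon_deg (Poly_Mapping.single v n) = n"
  by (simp_all add: mon_deg_def lookup_add sum.distrib lookup_single when_def)

lemma finite_mon_deg_le: "finite {m :: 'v::finite \<Rightarrow>\<^sub>0 nat. mon_deg m \<le> d}"
proof (rule inj_on_finite)
  show "inj_on Poly_Mapping.lookup {m :: 'v \<Rightarrow>\<^sub>0 nat. mon_deg m \<le> d}"
    by (rule inj_onI, rule poly_mapping_eqI) simp
  show "Poly_Mapping.lookup ` {m :: 'v \<Rightarrow>\<^sub>0 nat. mon_deg m \<le> d}
    \<subseteq> {f. \<forall>v. (v \<in> UNIV \<longrightarrow> f v \<in> {..d}) \<and> (v \<notin> UNIV \<longrightarrow> f v = 0)}"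
  proof (intro image_subsetI CollectI allI conjI impI)
    fix m :: "'v \<Rightarrow>\<^sub>0 nat" and v assume m: "m \<in> {m. mon_deg m \<le> d}"
    have "Poly_Mapping.lookup m v \<le> mon_deg m"
      unfolding mon_deg_def by (rule member_le_sum) auto
    then show "Poly_Mapping.lookup m v \<in> {..d}" using m by simp
  qed simp
  show "finite {f. \<forall>v :: 'v. (v \<in> UNIV \<longrightarrow> f v \<in> {..d}) \<and> (v \<notin> UNIV \<longrightarrow> f v = 0)}"
    by (rule finite_set_of_finite_funs) auto
qed

lemma mon_deg_pos_split:
  assumes "mon_deg m = Suc t"
  obtains v m' where "m = Poly_Mapping.single v 1 + m'" "mon_deg m' = t"
proof -
  obtain v where v: "Poly_Mapping.lookup m v \<noteq> 0"
    using assms unfolding mon_deg_def by (metis sum.neutral nat.distinct(1))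
  have "m = Poly_Mapping.single v 1 + (m - Poly_Mapping.single v 1)"
    by (rule poly_mapping_eqI)
      (use v in \<open>auto simp: lookup_add lookup_minus lookup_single when_def\<close>)
  then show ?thesis using assms that by (metis mon_deg_simps(2,3) diff_add_inverse plus_1_eq_Suc)
qed

lemma lookup_kscale [simp]: "Poly_Mapping.lookup (kscale c f) m = c * Poly_Mapping.lookup f m"
  unfolding kscale_def mult_map_scale_conv_mult[symmetric]
  by (simp add: Poly_Mapping.map.rep_eq when_def)

lemma kscale_mult_left: "kscale c f * g = kscale c (f * g)"
  and kscale_mult_right: "g * kscale c f = kscale c (g * f)"
  unfolding kscale_def by (simp only: mult.assoc, simp only: mult.left_commute)

lemma sum_monomials:
  "f = (\<Sum>m\<in>Poly_Mapping.keys f. kscale (Poly_Mapping.lookup f m) (monomial m))"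
proof (rule poly_mapping_eqI)
  fix k
  have "(\<Sum>m\<in>Poly_Mapping.keys f. Poly_Mapping.lookup f m * Poly_Mapping.lookup (monomial m) k)
    = (\<Sum>m\<in>Poly_Mapping.keys f. if m = k then Poly_Mapping.lookup f m else 0)"
    by (intro sum.cong) (auto simp: lookup_single when_def)
  then show "Poly_Mapping.lookup f k = Poly_Mapping.lookup (\<Sum>m\<in>Poly_Mapping.keys f.
      kscale (Poly_Mapping.lookup f m) (monomial m)) k"
    by (simp add: lookup_sum in_keys_iff)
qed

lemma forms_iff: "f \<in> forms d \<longleftrightarrow> (\<forall>m. Poly_Mapping.lookup f m \<noteq> 0 \<longrightarrow> mon_deg m = d)"
  by (auto simp: forms_def in_keys_iff)

lemma subspace_forms: "vs.subspace (forms d)"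
proof (rule vs.subspaceI)
  fix x y :: "('b, 'a) mpol" assume "x \<in> forms d" "y \<in> forms d"
  then show "x + y \<in> forms d" unfolding forms_iff by (metis add.left_neutral lookup_add)
qed (auto simp: forms_iff)

lemma monomial_in_forms: "monomial m \<in> forms (mon_deg m)"
  by (simp add: forms_iff lookup_single)

lemma var_in_forms: "var v \<in> forms 1"
  using monomial_in_forms[of "Poly_Mapping.single v 1"] by (simp add: var_def)

lemma one_in_forms: "1 \<in> forms 0"
  using monomial_in_forms[of 0] by simp

lemma forms_mult: "f \<in> forms a \<Longrightarrow> g \<in> forms b \<Longrightarrow> f * g \<in> forms (a + b)"
  using keys_mult[of f g] unfolding forms_def by fastforce

lemma forms_disjoint: "f \<in> forms a \<Longrightarrow> f \<in> forms b \<Longrightarrow> f \<noteq> 0 \<Longrightarrow> a = b"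
  unfolding forms_iff by (metis lookup_zero poly_mapping_eqI)

lemma forms_subset_span_monomials:
  "forms d \<subseteq> vs.span (monomial ` {m. mon_deg m \<le> d})"
proof
  fix f :: "('a, 'b) mpol" assume f: "f \<in> forms d"
  show "f \<in> vs.span (monomial ` {m. mon_deg m \<le> d})"
    by (subst sum_monomials, intro vs.span_sum vs.span_scale vs.span_base imageI)
      (use f in \<open>auto simp: forms_def\<close>)
qed

definition hom_component :: "nat \<Rightarrow> ('v::finite, 'k::field) mpol \<Rightarrow> ('v, 'k) mpol"
  where "hom_component d f = Poly_Mapping.mapp (\<lambda>m c. c when mon_deg m = d) f"

lemma lookup_hom_component: "Poly_Mapping.lookup (hom_component d f) m = (if mon_deg m = d then Poly_Mapping.lookup f m else 0)"
  by (simp add: hom_component_def lookup_mapp when_def in_keys_iff)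

lemma hom_component_in_forms: "hom_component d f \<in> forms d"
  by (simp add: forms_iff lookup_hom_component)

lemma hom_component_add: "hom_component d (f + g) = hom_component d f + hom_component d g"
  and hom_component_diff: "hom_component d (f - g) = hom_component d f - hom_component d g"
  and hom_component_zero [simp]: "hom_component d 0 = 0"
  by (rule poly_mapping_eqI, simp add: lookup_hom_component lookup_add lookup_minus)+

lemma hom_component_sum: "hom_component d (sum f A) = (\<Sum>a\<in>A. hom_component d (f a))"
  by (rule poly_mapping_eqI) (simp add: lookup_hom_component lookup_sum)

lemma hom_component_of_form: "f \<in> forms e \<Longrightarrow> hom_component d f = (if d = e then f else 0)"
  by (rule poly_mapping_eqI) (auto simp: lookup_hom_component forms_iff)

lemma sum_hom_component: "f = (\<Sum>d\<in>mon_deg ` Poly_Mapping.keys f. hom_component d f)"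
proof (rule poly_mapping_eqI)
  fix m
  show "Poly_Mapping.lookup f m = Poly_Mapping.lookup (\<Sum>d\<in>mon_deg ` Poly_Mapping.keys f. hom_component d f) m"
    by (auto simp: lookup_sum lookup_hom_component in_keys_iff)
qed

lemma hom_component_mult_form:
  assumes g: "g \<in> forms e"
  shows "hom_component n (f * g) = (if e \<le> n then hom_component (n - e) f * g else 0)"
proof -
  let ?D = "mon_deg ` Poly_Mapping.keys f"
  have "hom_component n (f * g) = (\<Sum>d\<in>?D. hom_component n (hom_component d f * g))"
    by (subst (1) sum_hom_component[of f]) (simp only: sum_distrib_right hom_component_sum)
  also have "\<dots> = (\<Sum>d\<in>?D. if d + e = n then hom_component d f * g else 0)"
    using hom_component_of_form[OF forms_mult[OF hom_component_in_forms g]] by (intro sum.cong) auto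
  also have "\<dots> = (if e \<le> n then \<Sum>d\<in>?D. if d = n - e then hom_component d f * g else 0 else 0)"
  proof (cases "e \<le> n")
    case True
    then have "d + e = n \<longleftrightarrow> d = n - e" for d by auto
    then show ?thesis using True by simp
  qed (auto intro!: sum.neutral)
  also have "\<dots> = (if e \<le> n then hom_component (n - e) f * g else 0)"
  proof -
    have "hom_component k f = 0" if "k \<notin> ?D" for k
      by (rule poly_mapping_eqI) (use that in \<open>auto simp: lookup_hom_component in_keys_iff\<close>)
    then show ?thesis by (auto simp: sum.delta)
  qed
  finally show ?thesis .
qed

lemma ideal_mult: "is_ideal H \<Longrightarrow> f \<in> H \<Longrightarrow> f * g \<in> H" "is_ideal H \<Longrightarrow> f \<in> H \<Longrightarrow> g * f \<in> H"
  using ideal.subspace_scale by (metis mult.commute)+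

lemma subspace_ideal: "is_ideal H \<Longrightarrow> vs.subspace H"
  by (rule vs.subspaceI)
    (simp_all add: kscale_def ideal.subspace_0 ideal.subspace_add ideal.subspace_scale)

text \<open>
  Stated for the components of an arbitrary element of the ideal, rather than for its forms of degree \<open>n\<close>, so that
  the induction over the span goes through: the partial sums of a form need not be forms.
\<close>

lemma hom_component_ideal_in_span:
  assumes G: "G \<subseteq> (\<Union>d. forms d)" and x: "x \<in> ideal_of G"
  shows "hom_component n x \<in> kspan {monomial m * g | m g. g \<in> G \<and> (\<exists>e. g \<in> forms e \<and> mon_deg m + e = n)}"
    (is "_ \<in> kspan ?M")
  using x
proof (induction rule: ideal.span_induct_alt)
  case base
  then show ?case by (simp add: vs.span_zero)
next
  case (step c g y)
  obtain e where e: "g \<in> forms e" using G step(1) by blast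
  have "hom_component n (c * g) \<in> kspan ?M"
  proof (cases "e \<le> n")
    case True
    let ?c = "hom_component (n - e) c"
    have "hom_component n (c * g) = (\<Sum>m\<in>Poly_Mapping.keys ?c. kscale (Poly_Mapping.lookup ?c m) (monomial m)) * g"
      using True hom_component_mult_form[OF e] sum_monomials[of ?c] by simp
    also have "\<dots> = (\<Sum>m\<in>Poly_Mapping.keys ?c. kscale (Poly_Mapping.lookup ?c m) (monomial m * g))"
      by (simp add: sum_distrib_right kscale_mult_left)
    also have "\<dots> \<in> kspan ?M"
    proof (intro vs.span_sum vs.span_scale vs.span_base)
      fix m assume "m \<in> Poly_Mapping.keys ?c"
      then have "mon_deg m = n - e" using hom_component_in_forms[of "n - e" c] by (auto simp: forms_def)
      then show "monomial m * g \<in> ?M" using step(1) e True by force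
    qed
    finally show ?thesis .
  qed (simp add: hom_component_mult_form[OF e] vs.span_zero)
  then show ?case by (simp only: hom_component_add vs.span_add step(2))
qed

lemma hom_component_in_ideal:
  assumes "G \<subseteq> (\<Union>d. forms d)" and "x \<in> ideal_of G"
  shows "hom_component n x \<in> ideal_of G"
proof -
  have "kspan {monomial m * g | m g. g \<in> G \<and> (\<exists>e. g \<in> forms e \<and> mon_deg m + e = n)} \<subseteq> ideal_of G"
    by (intro vs.span_minimal subspace_ideal) (auto intro: ideal.span_scale ideal.span_base)
  then show ?thesis using hom_component_ideal_in_span[OF assms] by blast
qed

text \<open>
  Modulo the ideal of \<open>G\<close>, a form of the larger ideal is a multiple of \<open>f\<close>; taking components of degree \<open>n\<close>, the
  multiplier can be chosen homogeneous, and it vanishes if \<open>n < d\<close>, which is the case of the next lemma.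
\<close>

lemma ideal_of_insert_form:
  assumes G: "G \<subseteq> (\<Union>d. forms d)" and f: "f \<in> forms d"
    and b: "b \<in> ideal_of (insert f G)" "b \<in> forms n" and "d \<le> n"
  shows "\<exists>a\<in>forms (n - d). b - a * f \<in> ideal_of G"
proof -
  obtain k where "b - k * f \<in> ideal_of G"
    using b(1) unfolding ideal.span_breakdown_eq by blast
  then have "hom_component n (b - k * f) \<in> ideal_of G" using G by (rule hom_component_in_ideal[rotated])
  then have "b - hom_component (n - d) k * f \<in> ideal_of G"
    using hom_component_of_form[OF b(2), of n] hom_component_mult_form[OF f, of n k] \<open>d \<le> n\<close>
    by (simp add: hom_component_diff)
  then show ?thesis using hom_component_in_forms by blast
qed

lemma ideal_of_insert_form_below:
  assumes G: "G \<subseteq> (\<Union>d. forms d)" and f: "f \<in> forms d"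
    and b: "b \<in> ideal_of (insert f G)" "b \<in> forms n" and "n < d"
  shows "b \<in> ideal_of G"
proof -
  obtain k where "b - k * f \<in> ideal_of G"
    using b(1) unfolding ideal.span_breakdown_eq by blast
  then have "hom_component n (b - k * f) \<in> ideal_of G" using G by (rule hom_component_in_ideal[rotated])
  then show ?thesis
    using hom_component_of_form[OF b(2), of n] hom_component_mult_form[OF f, of n k] \<open>n < d\<close>
    by (simp add: hom_component_diff)
qed

lemma subspace_from_below: "vs.subspace (from_below I d)"
  unfolding from_below_def by (rule vs.subspace_span)

lemma from_below_subset:
  assumes "is_ideal I"
  shows "from_below I d \<subseteq> I \<inter> forms d"
  unfolding from_below_def
proof (rule vs.span_minimal)
  show "vs.subspace (I \<inter> forms d)"
    using subspace_ideal[OF assms] subspace_forms by (rule vs.subspace_inter)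
  show "{f * l |f l e. Suc e = d \<and> f \<in> I \<inter> forms e \<and> l \<in> forms 1} \<subseteq> I \<inter> forms d"
    using ideal_mult(1)[OF assms] forms_mult by fastforce
qed

text \<open>
  A monomial of positive degree splits off a variable, and the remaining factor is absorbed by \<open>I\<close>.
\<close>

lemma from_below_mult:
  assumes I: "is_ideal I" and f: "f \<in> I" "f \<in> forms e" and s: "s \<in> forms t" and "t > 0"
  shows "f * s \<in> from_below I (e + t)"
proof -
  have mon: "f * monomial m \<in> from_below I (e + t)" if m: "mon_deg m = t" for m
  proof -
    obtain t' where t': "t = Suc t'" using \<open>t > 0\<close> by (cases t) auto
    then obtain v m' where m': "m = Poly_Mapping.single v 1 + m'" "mon_deg m' = t'"
      using m mon_deg_pos_split by blast
    have "f * monomial m = (f * monomial m') * var v"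
      unfolding m' var_def by (simp add: mult.assoc mult_single add.commute)
    moreover have "f * monomial m' \<in> I \<inter> forms (e + t')"
      using ideal_mult(1)[OF I f(1)] forms_mult[OF f(2) monomial_in_forms[of m']] m' by simp
    moreover have "Suc (e + t') = e + t" using t' by simp
    ultimately show ?thesis
      unfolding from_below_def using var_in_forms[of v] by (intro vs.span_base CollectI) blast
  qed
  have "f * s = (\<Sum>m\<in>Poly_Mapping.keys s. kscale (Poly_Mapping.lookup s m) (f * monomial m))"
    by (subst (1) sum_monomials[of s]) (simp add: sum_distrib_left kscale_mult_right)
  also have "\<dots> \<in> from_below I (e + t)"
    using s mon subspace_from_below[of I "e + t"]
    by (intro vs.subspace_sum vs.subspace_scale) (auto simp: forms_def)
  finally show ?thesis .
qed

lemma from_below_subset_ideal: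
  assumes "\<And>e. e < d \<Longrightarrow> I \<inter> forms e \<subseteq> H" and H: "is_ideal H"
  shows "from_below I d \<subseteq> H"
  unfolding from_below_def
  using assms(1) ideal_mult(1)[OF H] by (intro vs.span_minimal subspace_ideal[OF H]) blast

lemma is_ideal_ideal_pow: "is_ideal (ideal_pow A t)"
  by (cases t) simp_all

lemma monomial_in_ideal_pow: "mon_deg m = t \<Longrightarrow> monomial m \<in> ideal_pow max_ideal t"
proof (induction t arbitrary: m)
  case (Suc t)
  then obtain v m' where m': "m = Poly_Mapping.single v 1 + m'" "mon_deg m' = t"
    using mon_deg_pos_split by blast
  have "monomial m = var v * monomial m'" unfolding m' var_def by (simp add: mult_single)
  moreover have "var v \<in> max_ideal" unfolding max_ideal_def by (intro ideal.span_base) simp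
  ultimately show ?case using Suc.IH[OF m'(2)] by (auto intro!: ideal.span_base)
qed simp

lemma forms_subset_ideal_pow: "forms t \<subseteq> ideal_pow max_ideal t"
proof
  fix f :: "('a, 'b) mpol" assume f: "f \<in> forms t"
  show "f \<in> ideal_pow max_ideal t"
    by (subst sum_monomials, intro vs.subspace_sum vs.subspace_scale subspace_ideal
        is_ideal_ideal_pow monomial_in_ideal_pow) (use f in \<open>auto simp: forms_def\<close>)
qed

lemma ideal_of_mult_subset:
  assumes J: "is_ideal J" and AB: "\<And>a b. a \<in> A \<Longrightarrow> b \<in> B \<Longrightarrow> a * b \<in> J"
    and a: "a \<in> ideal_of A" and b: "b \<in> ideal_of B"
  shows "a * b \<in> J"
  using a
proof (induction rule: ideal.span_induct_alt)
  case (step c x y)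
  have "x * b \<in> J" using b
  proof (induction rule: ideal.span_induct_alt)
    case (step c' x' y')
    then show ?case using AB[OF \<open>x \<in> A\<close>] ideal.subspace_scale[OF J, of "x * x'" c'] ideal.subspace_add[OF J]
      by (metis distrib_left mult.left_commute)
  qed (simp add: ideal.subspace_0[OF J])
  then show ?case
    using step ideal.subspace_scale[OF J, of "x * b" c] ideal.subspace_add[OF J]
    by (metis distrib_right mult.assoc)
qed (simp add: ideal.subspace_0[OF J])

lemma ideal_pow_subset_forms: "ideal_pow max_ideal t \<subseteq> ideal_of (forms t)"
proof (induction t)
  case 0
  have "x * 1 \<in> ideal_of (forms 0)" for x :: "('a, 'b) mpol"
    by (intro ideal.span_scale ideal.span_base one_in_forms)
  then show ?case by auto
next
  case (Suc t)
  have "a * b \<in> ideal_of (forms (Suc t))" if "a \<in> max_ideal" "b \<in> ideal_pow max_ideal t"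
    for a b :: "('a, 'b) mpol"
  proof (rule ideal_of_mult_subset)
    show "a \<in> ideal_of (range var)" using that(1) unfolding max_ideal_def .
    show "b \<in> ideal_of (forms t)" using that(2) Suc by blast
    fix x y :: "('a, 'b) mpol" assume "x \<in> range var" "y \<in> forms t"
    then show "x * y \<in> ideal_of (forms (Suc t))"
      using forms_mult[OF var_in_forms, of y t] by (auto intro!: ideal.span_base)
  qed simp
  then show ?case
    unfolding ideal_pow.simps by (intro ideal.span_minimal ideal.subspace_span) blast
qed

text \<open>
  The ideal \<open>ideal_pow max_ideal t\<close> lies between the forms of degree \<open>t\<close> and the ideal that they generate, so testing
  forms suffices. This puts saturation within reach of linear algebra in a single degree.
\<close>

lemma sat_iff_forms:
  assumes H: "is_ideal H"
  shows "f \<in> sat H \<longleftrightarrow> (\<exists>t. \<forall>g\<in>forms t. f * g \<in> H)"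
proof
  assume "f \<in> sat H"
  then show "\<exists>t. \<forall>g\<in>forms t. f * g \<in> H"
    unfolding sat_def using forms_subset_ideal_pow by blast
next
  assume "\<exists>t. \<forall>g\<in>forms t. f * g \<in> H"
  then obtain t where t: "\<And>g. g \<in> forms t \<Longrightarrow> f * g \<in> H" by blast
  have "f * g \<in> H" if "g \<in> ideal_pow max_ideal t" for g
  proof (rule ideal_of_mult_subset[OF H])
    show "f \<in> ideal_of {f}" by (intro ideal.span_base) simp
    show "g \<in> ideal_of (forms t)" using that ideal_pow_subset_forms by blast
  qed (use t in auto)
  then show "f \<in> sat H" unfolding sat_def by blast
qed

lemma sat_mono: "H \<subseteq> H' \<Longrightarrow> sat H \<subseteq> sat H'"
  unfolding sat_def by blast

lemma sat_add:
  assumes "is_ideal H" "f \<in> sat H" "h \<in> H"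
  shows "f + h \<in> sat H"
  using assms(2) ideal_mult(1)[OF assms(1,3)] ideal.subspace_add[OF assms(1)]
  unfolding sat_def by (fastforce simp: distrib_right)

section \<open>Standard bases degree by degree\<close>

lemma homogeneous_ideal_is_ideal: "homogeneous_ideal I \<Longrightarrow> is_ideal I"
  by (simp add: homogeneous_ideal_def)

lemma subspace_piece: "is_ideal I \<Longrightarrow> vs.subspace (I \<inter> forms d)"
  using subspace_ideal subspace_forms by (rule vs.subspace_inter)

abbreviation piece_basis :: "('v::finite, 'k::field) mpol set \<Rightarrow> nat \<Rightarrow> ('v, 'k) mpol set \<Rightarrow> bool"
  where "piece_basis I d D \<equiv> quotient_basis D (I \<inter> forms d) (from_below I d)"

lemma piece_basis_exists:
  assumes "is_ideal I"
  shows "\<exists>D. piece_basis I d D"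
  using quotient_basis_exists subspace_from_below subspace_piece[OF assms] from_below_subset[OF assms]
  by blast

text \<open>
  The dimension of \<open>I\<^sub>d / I\<^sub>d\<^sub>-\<^sub>1 S\<^sub>1\<close>, by \<open>piece_basis_card\<close> the number of elements of degree \<open>d\<close> in every
  standard basis.
\<close>

definition num_gens :: "('v::finite, 'k::field) mpol set \<Rightarrow> nat \<Rightarrow> nat"
  where "num_gens I d = vs.dim (I \<inter> forms d) - vs.dim (from_below I d)"

lemma piece_basis_card:
  assumes I: "is_ideal I" and D: "piece_basis I d D"
  shows "finite D" "card D = num_gens I d"
    and "num_gens I d + vs.dim (from_below I d) = vs.dim (I \<inter> forms d)"
proof -
  have fin: "finite (monomial ` {m. mon_deg m \<le> d} :: ('a, 'b) mpol set)"
    using finite_mon_deg_le by blast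
  have sub: "I \<inter> forms d \<subseteq> vs.span (monomial ` {m. mon_deg m \<le> d})"
    using forms_subset_span_monomials by blast
  note * = quotient_basis_card[OF D subspace_from_below subspace_piece[OF I] from_below_subset[OF I] fin sub]
  show "finite D" by (rule *(1))
  show "card D = num_gens I d" using *(2) unfolding num_gens_def by simp
  then show "num_gens I d + vs.dim (from_below I d) = vs.dim (I \<inter> forms d)" using *(2) by simp
qed

lemma piece_basis_subset: "piece_basis I d D \<Longrightarrow> D \<subseteq> I \<inter> forms d"
  by (rule quotient_basisD(1))

lemma zero_notin_piece_basis:
  assumes "piece_basis I d D"
  shows "0 \<notin> D"
proof
  assume "0 \<in> D"
  then have "(1 :: 'b) = 0"
    using vs.subspace_0[OF subspace_from_below, of I d]
    by (intro quotient_basisD(2)[OF assms, of "{0}" "\<lambda>_. 1" 0]) auto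
  then show False by simp
qed

text \<open>
  By induction on the degree: a form of \<open>I\<close> of degree \<open>d\<close> is a combination of \<open>D d\<close> plus an element of
  \<open>I\<^sub>d\<^sub>-\<^sub>1 S\<^sub>1\<close>, and \<open>I\<close> is generated by its forms.
\<close>

lemma piece_bases_generate:
  assumes I: "homogeneous_ideal I" and D: "\<And>d. piece_basis I d (D d)"
  shows "ideal_of (\<Union>d. D d) = I"
proof
  note id = homogeneous_ideal_is_ideal[OF I]
  show "ideal_of (\<Union>d. D d) \<subseteq> I"
    using piece_basis_subset[OF D] id by (intro ideal.span_minimal) blast+
  have pieces: "I \<inter> forms d \<subseteq> ideal_of (\<Union>d. D d)" for d
  proof (induction d rule: less_induct)
    case (less d)
    show ?case
    proof
      fix g assume g: "g \<in> I \<inter> forms d"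
      obtain F c where F: "F \<subseteq> D d" "g - (\<Sum>f\<in>F. kscale (c f) f) \<in> from_below I d"
        using quotient_basisD(3)[OF D[of d] g] by (elim exE conjE) (rule that)
      have "g - (\<Sum>f\<in>F. kscale (c f) f) \<in> ideal_of (\<Union>d. D d)"
        using from_below_subset_ideal[OF less.IH ideal.subspace_span] F(2) by (rule subsetD)
      moreover have "(\<Sum>f\<in>F. kscale (c f) f) \<in> ideal_of (\<Union>d. D d)"
        using F(1) unfolding kscale_def
        by (intro ideal.span_sum ideal.span_scale ideal.span_base) auto
      ultimately show "g \<in> ideal_of (\<Union>d. D d)"
        using ideal.span_add by fastforce
    qed
  qed
  obtain G where G: "G \<subseteq> (\<Union>d. forms d)" "I = ideal_of G"
    using I unfolding homogeneous_ideal_def by blast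
  then have "G \<subseteq> I" using ideal.span_superset by blast
  then have "G \<subseteq> ideal_of (\<Union>d. D d)" using pieces G(1) by blast
  then show "I \<subseteq> ideal_of (\<Union>d. D d)"
    unfolding G(2) by (intro ideal.span_minimal ideal.subspace_span)
qed

lemma Union_pieces_Int_forms:
  assumes D: "\<And>d. piece_basis I d (D d)"
  shows "(\<Union>d. D d) \<inter> forms d = D d"
proof
  show "D d \<subseteq> (\<Union>d. D d) \<inter> forms d" using piece_basis_subset[OF D] by blast
  show "(\<Union>d. D d) \<inter> forms d \<subseteq> D d"
  proof
    fix f assume f: "f \<in> (\<Union>d. D d) \<inter> forms d"
    then obtain e where e: "f \<in> D e" by blast
    then have "f \<noteq> 0" "f \<in> forms e"
      using zero_notin_piece_basis[OF D] piece_basis_subset[OF D] by blast+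
    then show "f \<in> D d" using forms_disjoint[of f d e] f e by auto
  qed
qed

lemma standard_basis_of_pieces:
  assumes I: "homogeneous_ideal I" and D: "\<And>d. piece_basis I d (D d)"
  shows "\<exists>r. standard_basis I (\<Union>d. D d) r"
proof -
  obtain r where "well_order_on (\<Union>d. D d) r" using well_order_on by blast
  then have "linear_order_on (\<Union>d. D d) r" by (simp add: well_order_on_def)
  then show ?thesis
    unfolding standard_basis_def Union_pieces_Int_forms[OF D]
    using piece_bases_generate[OF I D] D piece_basis_subset[OF D] by blast
qed

lemma standard_basis_piece: "standard_basis I B r \<Longrightarrow> piece_basis I d (B \<inter> forms d)"
  by (simp add: standard_basis_def)

lemma essential_in_degree:
  "{f \<in> forms d. essential B f} = {f \<in> B \<inter> forms d. f \<notin> sat (ideal_of (B - {f}))}"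
  by (auto simp: essential_def inessential_def)

lemma num_essential_le:
  assumes "is_ideal I" "standard_basis I B r"
  shows "num_essential B d \<le> num_gens I d" "finite {f \<in> forms d. essential B f}"
proof -
  note * = piece_basis_card[OF assms(1) standard_basis_piece[OF assms(2)], of d]
  show "num_essential B d \<le> num_gens I d"
    unfolding num_essential_def essential_in_degree *(2)[symmetric]
    by (rule card_mono[OF *(1)]) blast
  show "finite {f \<in> forms d. essential B f}"
    unfolding essential_in_degree by (rule finite_subset[OF _ *(1)]) blast
qed

lemma standard_basis_exists:
  assumes "homogeneous_ideal I"
  shows "\<exists>B r. standard_basis I B r"
proof -
  have "\<exists>D. \<forall>d. piece_basis I d (D d)"
    using piece_basis_exists[OF homogeneous_ideal_is_ideal[OF assms]] by (intro choice) blast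
  then show ?thesis using standard_basis_of_pieces[OF assms] by blast
qed

text \<open>
  The greatest number exists because every standard basis has \<open>num_gens I d\<close> elements of degree \<open>d\<close>.
\<close>

lemma nu_e_attained:
  assumes I: "homogeneous_ideal I"
  shows "\<exists>B r. standard_basis I B r \<and> num_essential B d = nu_e I d" (is ?attained)
    and num_essential_le_nu_e: "standard_basis I B r \<Longrightarrow> num_essential B d \<le> nu_e I d"
proof -
  let ?P = "\<lambda>k. \<exists>B r. standard_basis I B r \<and> num_essential B d = k"
  obtain B0 r0 where "standard_basis I B0 r0" using standard_basis_exists[OF I] by blast
  then have P: "?P (num_essential B0 d)" by blast
  have bound: "\<And>k. ?P k \<Longrightarrow> k \<le> num_gens I d"
    using num_essential_le(1)[OF homogeneous_ideal_is_ideal[OF I]] by blast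
  show ?attained
    unfolding nu_e_def by (rule GreatestI_nat[where P = ?P, OF P bound])
  show "num_essential B d \<le> nu_e I d" if "standard_basis I B r"
  proof -
    have "?P (num_essential B d)" using that by blast
    then show ?thesis
      unfolding nu_e_def using bound by (rule Greatest_le_nat[where P = ?P])
  qed
qed

lemma mu_e_attained:
  assumes I: "homogeneous_ideal I"
  shows "\<exists>B r. standard_basis I B r \<and> num_essential B d = mu_e I d"
proof -
  let ?P = "\<lambda>k. \<exists>B r. standard_basis I B r \<and> num_essential B d = k"
  have "\<exists>k. ?P k" using standard_basis_exists[OF I] by blast
  then show ?thesis unfolding mu_e_def by (rule LeastI_ex)
qed

lemma mu_e_le_num_essential:
  assumes "standard_basis I B r"
  shows "mu_e I d \<le> num_essential B d"
proof -
  have "\<exists>B' r. standard_basis I B' r \<and> num_essential B' d = num_essential B d"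
    using assms by blast
  then show ?thesis unfolding mu_e_def by (rule Least_le)
qed

section \<open>A standard basis with the most essential elements in every degree\<close>

text \<open>
  Corrects \<open>b\<close>, of degree \<open>e\<close>, by multiples of the already corrected elements of \<open>E d\<close> for all \<open>d < e\<close>. The
  coefficients \<open>A d f e b\<close> are given in advance: they are chosen for the original \<open>f\<close> and \<open>b\<close>, and remain valid
  since all corrections of \<open>f\<close> lie in the ideal modulo which they work.
\<close>

function adjust :: "(nat \<Rightarrow> 'a set) \<Rightarrow> (nat \<Rightarrow> 'a \<Rightarrow> nat \<Rightarrow> 'a \<Rightarrow> 'a) \<Rightarrow> nat \<Rightarrow> 'a::comm_ring_1 \<Rightarrow> 'a"
  where "adjust E A e b = b - (\<Sum>d<e. \<Sum>f\<in>E d. A d f e b * adjust E A d f)"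
  by pat_completeness auto
termination by (relation "measure (\<lambda>(E, A, e, b). e)") auto

declare adjust.simps [simp del]

text \<open>
  The element \<open>f \<in> E d\<close> is essential in \<open>Bs d\<close> because it avoids the saturation of \<open>H d f\<close>. The corrected family
  \<open>\<tau>\<close> is arranged so that all its members except \<open>\<tau> d f\<close> lie in \<open>H d f\<close>. For members of degree
  \<open>< d\<close> this is automatic, in degree \<open>d\<close> it holds because corrections stay in \<open>from_below I d \<subseteq> H d f\<close>,
  and in degree \<open>> d\<close> it is the purpose of the summand of index \<open>(d, f)\<close> of the correction, the other summands
  being in \<open>H d f\<close> by induction.
\<close>

lemma simultaneous_essential_basis:
  assumes I: "homogeneous_ideal I" and sb: "\<And>d. standard_basis I (Bs d) (rs d)"
  shows "\<exists>B r. standard_basis I B r \<and> (\<forall>d. num_essential (Bs d) d \<le> num_essential B d)"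
proof -
  note id = homogeneous_ideal_is_ideal[OF I]
  define E where "E d = {f \<in> forms d. essential (Bs d) f}" for d
  define H where "H d f = ideal_of (Bs d - {f})" for d f
  note C = standard_basis_piece[OF sb]
  have idH: "is_ideal (H d f)" for d f unfolding H_def by simp
  have E_sub: "E d \<subseteq> Bs d \<inter> forms d" and E_nsat: "f \<in> E d \<Longrightarrow> f \<notin> sat (H d f)" for d f
    unfolding E_def essential_in_degree H_def by auto
  have finE: "finite (E d)" for d unfolding E_def using num_essential_le(2)[OF id sb] .
  have CI: "Bs d \<inter> forms d \<subseteq> I \<inter> forms d" for d using C by (rule piece_basis_subset)
  have homG: "Bs d - {f} \<subseteq> (\<Union>d. forms d)" for d f
    using sb[of d] unfolding standard_basis_def by blast
  have gen: "ideal_of (insert f (Bs d - {f})) = I" if "f \<in> E d" for d f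
  proof -
    have "insert f (Bs d - {f}) = Bs d" using that E_sub by blast
    then show ?thesis using sb[of d] unfolding standard_basis_def by simp
  qed
  have low: "I \<inter> forms e \<subseteq> H d f" if "f \<in> E d" "e < d" for d e f
    unfolding H_def gen[OF that(1), symmetric]
    using ideal_of_insert_form_below[OF homG _ _ _ that(2)] that(1) E_sub by blast
  then have below: "from_below I d \<subseteq> H d f" if "f \<in> E d" for d f
    using that idH by (intro from_below_subset_ideal)
  have same: "b \<in> H d f" if "b \<in> Bs d" "b \<noteq> f" for b d f
    unfolding H_def using that by (intro ideal.span_base) simp
  define A where "A d f e b = (SOME a. a \<in> forms (e - d) \<and> b - a * f \<in> H d f)" for d f e b
  have A: "A d f e b \<in> forms (e - d) \<and> b - A d f e b * f \<in> H d f"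
    if "f \<in> E d" "b \<in> I \<inter> forms e" "d \<le> e" for d f e b
  proof -
    have "\<exists>a\<in>forms (e - d). b - a * f \<in> H d f"
      unfolding H_def
      by (rule ideal_of_insert_form[OF homG]) (use that E_sub gen[OF that(1)] in auto)
    then have "\<exists>a. a \<in> forms (e - d) \<and> b - a * f \<in> H d f" by blast
    then show ?thesis unfolding A_def by (rule someI_ex)
  qed
  define \<tau> where "\<tau> = adjust E A"
  have \<tau>: "\<tau> e b = b - (\<Sum>d<e. \<Sum>f\<in>E d. A d f e b * \<tau> d f)" for e b
    unfolding \<tau>_def by (rule adjust.simps)
  have congr: "\<tau> e b - b \<in> from_below I e" if "b \<in> I \<inter> forms e" for e b
    using that
  proof (induction e arbitrary: b rule: less_induct)
    case (less e)
    have "A d f e b * \<tau> d f \<in> from_below I e" if df: "d < e" "f \<in> E d" for d f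
    proof -
      have f: "f \<in> I \<inter> forms d" using df(2) E_sub CI by blast
      have "\<tau> d f - f \<in> I \<inter> forms d"
        using less.IH[OF df(1) f] from_below_subset[OF id] by blast
      then have "(\<tau> d f - f) + f \<in> I \<inter> forms d"
        using f subspace_piece[OF id] vs.subspace_add by blast
      then have "\<tau> d f * A d f e b \<in> from_below I (d + (e - d))"
        using A[OF df(2) less.prems] df(1) by (intro from_below_mult[OF id]) auto
      then show ?thesis using df(1) by (simp add: mult.commute)
    qed
    then have "(\<Sum>d<e. \<Sum>f\<in>E d. A d f e b * \<tau> d f) \<in> from_below I e"
      by (intro vs.subspace_sum[OF subspace_from_below]) auto
    then show ?case
      unfolding \<tau>[of e b] using vs.subspace_neg[OF subspace_from_below] by fastforce
  qed
  have \<tau>_piece: "\<tau> e b \<in> I \<inter> forms e" if "b \<in> I \<inter> forms e" for e b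
    using vs.subspace_add[OF subspace_piece[OF id], of "\<tau> e b - b" e b] that congr[OF that]
      from_below_subset[OF id] by auto
  have others: "\<tau> e b \<in> H d f"
    if "f \<in> E d" "b \<in> Bs e \<inter> forms e" "(e, b) \<noteq> (d, f)" for d e f b
    using that(2,3)
  proof (induction e arbitrary: b rule: less_induct)
    case (less e)
    note H_add = ideal.subspace_add[OF idH] and H_diff = ideal.subspace_diff[OF idH]
    have b: "b \<in> I \<inter> forms e" using less.prems(1) CI by blast
    consider "e < d" | "e = d" | "d < e" by linarith
    then show ?case
    proof cases
      case 1
      then show ?thesis using low[OF that(1)] \<tau>_piece[OF b] by blast
    next
      case 2
      then have "b \<in> H d f" using less.prems by (intro same) auto
      moreover have "\<tau> e b - b \<in> H d f" using congr[OF b] below[OF that(1)] 2 by blast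
      ultimately show ?thesis using H_add by fastforce
    next
      case 3
      have f: "f \<in> I \<inter> forms d" using that(1) E_sub CI by blast
      let ?S = "SIGMA d':{..<e}. E d'"
      let ?t = "\<lambda>(d', f'). A d' f' e b * \<tau> d' f'"
      have finS: "finite ?S" using finE by blast
      have df: "(d, f) \<in> ?S" using 3 that(1) by simp
      have "(\<Sum>d'<e. \<Sum>f'\<in>E d'. A d' f' e b * \<tau> d' f') = (\<Sum>x\<in>?S. ?t x)"
        using finE by (subst sum.Sigma) auto
      also have "\<dots> = ?t (d, f) + (\<Sum>x\<in>?S - {(d, f)}. ?t x)"
        by (rule sum.remove[OF finS df])
      \<comment> \<open>The coefficient was chosen for \<open>f\<close>, but multiplies \<open>\<tau> d f\<close>; the difference is the middle term.\<close>
      finally have eq: "\<tau> e b = (b - A d f e b * f) - A d f e b * (\<tau> d f - f)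
          - (\<Sum>x\<in>?S - {(d, f)}. ?t x)"
        unfolding \<tau>[of e b] by (simp add: right_diff_distrib)
      have "b - A d f e b * f \<in> H d f" using A[OF that(1) b] 3 by simp
      moreover have "A d f e b * (\<tau> d f - f) \<in> H d f"
        using congr[OF f] below[OF that(1)] by (intro ideal_mult(2)[OF idH]) blast
      moreover have "(\<Sum>x\<in>?S - {(d, f)}. ?t x) \<in> H d f"
      proof (rule ideal.subspace_sum[OF idH])
        fix x assume x: "x \<in> ?S - {(d, f)}"
        then obtain d' f' where x': "x = (d', f')" "d' < e" "f' \<in> E d'" "(d', f') \<noteq> (d, f)"
          by auto
        then have "\<tau> d' f' \<in> H d f" using less.IH E_sub by blast
        then show "?t x \<in> H d f" using x' ideal_mult(2)[OF idH] by simp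
      qed
      ultimately show ?thesis unfolding eq using H_diff by blast
    qed
  qed
  define D where "D e = \<tau> e ` (Bs e \<inter> forms e)" for e
  have h: "\<And>b. b \<in> Bs e \<inter> forms e \<Longrightarrow> \<tau> e b - b \<in> from_below I e" for e
    using congr CI by blast
  have D: "piece_basis I e (D e)" and inj: "inj_on (\<tau> e) (Bs e \<inter> forms e)" for e
    unfolding D_def
    using quotient_basis_perturb[OF C subspace_from_below from_below_subset[OF id] subspace_piece[OF id] h]
    by blast+
  obtain r where r: "standard_basis I (\<Union>d. D d) r"
    using standard_basis_of_pieces[OF I D] by blast
  have "num_essential (Bs d) d \<le> num_essential (\<Union>d. D d) d" for d
  proof -
    have "\<tau> d f \<in> {f \<in> forms d. essential (\<Union>d. D d) f}" if f: "f \<in> E d" for f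
    proof -
      have "(\<Union>d. D d) - {\<tau> d f} \<subseteq> H d f" using others[OF f] unfolding D_def by blast
      then have "ideal_of ((\<Union>d. D d) - {\<tau> d f}) \<subseteq> H d f"
        using idH by (rule ideal.span_minimal)
      then have sub: "sat (ideal_of ((\<Union>d. D d) - {\<tau> d f})) \<subseteq> sat (H d f)" by (rule sat_mono)
      have fC: "f \<in> Bs d \<inter> forms d" using f E_sub by blast
      have "f - \<tau> d f \<in> H d f"
        using h[OF fC] below[OF f] ideal.subspace_neg[OF idH] by fastforce
      then have "\<tau> d f \<notin> sat (H d f)"
        using sat_add[OF idH, of "\<tau> d f" d f "f - \<tau> d f"] E_nsat[OF f] by auto
      then show ?thesis
        unfolding essential_in_degree Union_pieces_Int_forms[OF D]
        using sub fC unfolding D_def by blast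
    qed
    then have "\<tau> d ` E d \<subseteq> {f \<in> forms d. essential (\<Union>d. D d) f}" by blast
    then have "card (\<tau> d ` E d) \<le> num_essential (\<Union>d. D d) d"
      unfolding num_essential_def using num_essential_le(2)[OF id r] by (rule card_mono[rotated])
    moreover have "card (\<tau> d ` E d) = card (E d)"
      using inj E_sub by (meson card_image inj_on_subset)
    ultimately show ?thesis unfolding E_def num_essential_def by simp
  qed
  then show ?thesis using r by blast
qed

lemma basis_Max_exists:
  assumes I: "homogeneous_ideal I"
  shows "\<exists>B r. standard_basis I B r \<and> (\<forall>d. num_essential B d = nu_e I d)"
proof -
  obtain Bs rs where Bs: "\<And>d. standard_basis I (Bs d) (rs d)" "\<And>d. num_essential (Bs d) d = nu_e I d"
    using nu_e_attained[OF I] by metis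
  obtain B r where B: "standard_basis I B r" "\<And>d. num_essential (Bs d) d \<le> num_essential B d"
    using simultaneous_essential_basis[where Bs = Bs and rs = rs, OF I Bs(1)] by blast
  then show ?thesis using Bs(2) num_essential_le_nu_e[OF I B(1)] by (metis order_antisym)
qed

section \<open>Generators are needed in finitely many degrees only\<close>

lemma incseq_subseq_nat:
  fixes s :: "nat \<Rightarrow> nat"
  shows "\<exists>f. strict_mono f \<and> incseq (\<lambda>n. s (f n))"
proof -
  obtain f where f: "strict_mono f" "monoseq (\<lambda>n. s (f n))" using seq_monosub by blast
  show ?thesis
  proof (cases "incseq (\<lambda>n. s (f n))")
    case False
    then have dec: "decseq (\<lambda>n. s (f n))" using f(2) monoseq_iff by blast
    obtain n0 where n0: "\<And>n. s (f n0) \<le> s (f n)"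
      using ex_has_least_nat[of "\<lambda>_. True" 0 "\<lambda>n. s (f n)"] by blast
    have "s (f (n + n0)) = s (f n0)" for n
      using n0[of "n + n0"] decseqD[OF dec, of n0 "n + n0"] by simp
    then have "incseq (\<lambda>n. s (f (n + n0)))" by (simp add: incseq_def)
    moreover have "strict_mono (\<lambda>n. f (n + n0))"
      using f(1) by (simp add: strict_mono_def)
    ultimately show ?thesis by blast
  qed (use f(1) in blast)
qed

text \<open>
  Dickson's lemma, in the form that no infinite sequence of monomials is free of divisibilities: pass to a
  subsequence along which all exponents are nondecreasing.
\<close>

lemma dickson:
  fixes s :: "nat \<Rightarrow> ('v::finite \<Rightarrow>\<^sub>0 nat)"
  shows "\<exists>i j m. i < j \<and> s j = s i + m"
proof -
  have "\<exists>f. strict_mono f \<and> (\<forall>v\<in>V. incseq (\<lambda>n. Poly_Mapping.lookup (s (f n)) v))" for V :: "'v set"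
    using finite[of V]
  proof (induction V rule: finite_induct)
    case empty
    show ?case by (intro exI[of _ id]) (simp add: strict_mono_def)
  next
    case (insert v V)
    then obtain f where f: "strict_mono f" "\<And>v. v \<in> V \<Longrightarrow> incseq (\<lambda>n. Poly_Mapping.lookup (s (f n)) v)"
      by blast
    obtain g where g: "strict_mono g" "incseq (\<lambda>n. Poly_Mapping.lookup (s (f (g n))) v)"
      using incseq_subseq_nat[of "\<lambda>n. Poly_Mapping.lookup (s (f n)) v"] by blast
    have "incseq (\<lambda>n. Poly_Mapping.lookup (s (f (g n))) w)" if "w \<in> V" for w
      using f(2)[OF that] strict_mono_mono[OF g(1)] by (simp add: incseq_def mono_def)
    moreover have "strict_mono (\<lambda>n. f (g n))"
      using f(1) g(1) by (simp add: strict_mono_def)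
    ultimately show ?case using g(2) by (intro exI[of _ "\<lambda>n. f (g n)"]) auto
  qed
  from this[of UNIV] obtain f
    where f: "strict_mono f" "\<And>v. incseq (\<lambda>n. Poly_Mapping.lookup (s (f n)) v)"
    by auto
  have le: "Poly_Mapping.lookup (s (f 0)) v \<le> Poly_Mapping.lookup (s (f 1)) v" for v
    using f(2)[of v] by (simp add: incseq_def)
  have "s (f 1) = s (f 0) + (s (f 1) - s (f 0))"
    by (rule poly_mapping_eqI) (use le in \<open>simp add: lookup_add lookup_minus\<close>)
  moreover have "f 0 < f 1" using f(1) by (simp add: strict_mono_def)
  ultimately show ?thesis by blast
qed

text \<open>
  A monomial order is needed. Sending the variables to distinct primes embeds the monomials multiplicatively
  into the positive integers, whose order is total, compatible with products and well-founded.
\<close>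

lemma monomial_encoding:
  "\<exists>N :: ('v::finite \<Rightarrow>\<^sub>0 nat) \<Rightarrow> nat. inj N \<and> (\<forall>a b. N (a + b) = N a * N b) \<and> (\<forall>a. N a > 0)"
proof -
  obtain P where P: "P \<subseteq> {p::nat. prime p}" "finite P" "card P = card (UNIV :: 'v set)"
    using infinite_arbitrarily_large[OF primes_infinite, of "card (UNIV :: 'v set)"] by blast
  then obtain q :: "'v \<Rightarrow> nat" where q: "bij_betw q UNIV P"
    using finite_same_card_bij[of "UNIV :: 'v set" P] by auto
  have inj: "inj q" using q by (simp add: bij_betw_def)
  have prime: "prime (q v)" for v using q P(1) by (auto simp: bij_betw_def)
  define N where "N a = (\<Prod>v\<in>UNIV. q v ^ Poly_Mapping.lookup a v)" for a
  have N_image: "N a = (\<Prod>p\<in>range q. p ^ Poly_Mapping.lookup a (inv q p))" for a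
    unfolding N_def using inj by (subst prod.reindex) auto
  have mult: "multiplicity (q v) (N a) = Poly_Mapping.lookup a v" for a v
    unfolding N_image using prime inj
    by (subst multiplicity_prod_prime_powers) auto
  have "inj N"
    by (rule injI, rule poly_mapping_eqI) (metis mult)
  moreover have "N (a + b) = N a * N b" for a b
    by (simp add: N_def lookup_add power_add prod.distrib)
  moreover have "N a > 0" for a
    unfolding N_def using prime by (intro prod_pos) (auto simp: prime_gt_0_nat)
  ultimately show ?thesis by blast
qed

lemma mult_monomial_expand:
  "f * monomial m = (\<Sum>k\<in>Poly_Mapping.keys f. kscale (Poly_Mapping.lookup f k) (monomial (k + m)))"
  by (subst (1) sum_monomials[of f]) (simp add: sum_distrib_right kscale_mult_left mult_single)

lemma lookup_mult_monomial:
  "Poly_Mapping.lookup (f * monomial m) (k + m) = Poly_Mapping.lookup f k"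
proof -
  have "Poly_Mapping.lookup (f * monomial m) (k + m)
    = (\<Sum>l\<in>Poly_Mapping.keys f. if l = k then Poly_Mapping.lookup f l else 0)"
    unfolding mult_monomial_expand lookup_sum
    by (intro sum.cong) (auto simp: lookup_single when_def)
  then show ?thesis by (simp add: in_keys_iff)
qed

text \<open>
  If \<open>I\<close> had new elements in infinitely many degrees, choose in each such degree one with least leading monomial. By
  Dickson's lemma one of these leading monomials divides a later one; cancelling the later one with a multiple of
  the earlier element, which comes from below, leaves a new element with smaller leading monomial.
\<close>

lemma eventually_from_below:
  fixes I :: "('v::finite, 'k::field) mpol set"
  assumes id: "is_ideal I"
  shows "\<exists>n. \<forall>d\<ge>n. from_below I d = I \<inter> forms d"
proof (rule ccontr)
  assume contr: "\<nexists>n. \<forall>d\<ge>n. from_below I d = I \<inter> forms d"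
  define S where "S = {d. from_below I d \<noteq> I \<inter> forms d}"
  have "infinite S"
    using contr unfolding S_def infinite_nat_iff_unbounded_le by blast
  then obtain deg :: "nat \<Rightarrow> nat" where deg: "strict_mono deg" "\<And>n. deg n \<in> S"
    using infinite_enumerate[OF \<open>infinite S\<close>] by blast
  obtain N :: "('v \<Rightarrow>\<^sub>0 nat) \<Rightarrow> nat" where
    N: "inj N" "\<And>a b. N (a + b) = N a * N b" "\<And>a. N a > 0"
    using monomial_encoding by blast
  \<comment> \<open>\<open>lead f\<close> encodes the leading monomial of \<open>f\<close>, and \<open>new d f\<close> says that \<open>f\<close> is nonzero in \<open>I\<^sub>d / I\<^sub>d\<^sub>-\<^sub>1 S\<^sub>1\<close>.\<close>
  define lead where "lead f = Max (N ` Poly_Mapping.keys f)" for f :: "('v, 'k) mpol"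
  define new where "new d f \<longleftrightarrow> f \<in> I \<inter> forms d \<and> f \<notin> from_below I d" for d f
  have "\<exists>f. new (deg n) f \<and> (\<forall>g. new (deg n) g \<longrightarrow> lead f \<le> lead g)" for n
  proof -
    obtain f0 where "new (deg n) f0"
      using deg(2)[of n] from_below_subset[OF id] unfolding S_def new_def by blast
    then show ?thesis by (rule ex_has_least_nat)
  qed
  then obtain f where f: "\<And>n. new (deg n) (f n)"
    and least: "\<And>n g. new (deg n) g \<Longrightarrow> lead (f n) \<le> lead g"
    by metis
  have keys_ne: "Poly_Mapping.keys g \<noteq> {}" if "new d g" for d g
    using that vs.subspace_0[OF subspace_from_below, of I d] unfolding new_def by auto
  have "\<exists>m\<in>Poly_Mapping.keys (f n). N m = lead (f n)" for n
  proof -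
    have "lead (f n) \<in> N ` Poly_Mapping.keys (f n)"
      unfolding lead_def using keys_ne[OF f] by (intro Max_in) auto
    then show ?thesis by force
  qed
  then obtain lm where lm: "\<And>n. lm n \<in> Poly_Mapping.keys (f n)" "\<And>n. N (lm n) = lead (f n)"
    by metis
  have lead_ge: "N k \<le> N (lm n)" if "k \<in> Poly_Mapping.keys (f n)" for k n
    unfolding lm(2) lead_def using that by (intro Max_ge) auto
  obtain i j m where ij: "i < j" "lm j = lm i + m" using dickson[of lm] by blast
  have deg_lm: "mon_deg (lm n) = deg n" for n
    using lm(1)[of n] f[of n] unfolding new_def forms_def by blast
  have "deg i < deg j" using deg(1) ij(1) by (simp add: strict_mono_def)
  then have m: "mon_deg m > 0" "deg i + mon_deg m = deg j"
    using deg_lm[of i] deg_lm[of j] ij(2) by simp_all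
  have below: "f i * monomial m \<in> from_below I (deg j)"
    using from_below_mult[OF id _ _ monomial_in_forms m(1), of "f i" "deg i"] f[of i] m(2)
    unfolding new_def by auto
  define c where "c = Poly_Mapping.lookup (f j) (lm j) / Poly_Mapping.lookup (f i) (lm i)"
  define g where "g = f j - kscale c (f i * monomial m)"
  have scaled: "kscale c (f i * monomial m) \<in> from_below I (deg j)"
    using below by (rule vs.subspace_scale[OF subspace_from_below])
  have "new (deg j) g"
    unfolding new_def
  proof
    show "g \<in> I \<inter> forms (deg j)"
      unfolding g_def using f[of j] scaled from_below_subset[OF id] unfolding new_def
      by (intro vs.subspace_diff[OF subspace_piece[OF id]]) auto
    show "g \<notin> from_below I (deg j)"
    proof
      assume "g \<in> from_below I (deg j)"
      then have "g + kscale c (f i * monomial m) \<in> from_below I (deg j)"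
        using scaled by (rule vs.subspace_add[OF subspace_from_below])
      then show False using f[of j] unfolding g_def new_def by simp
    qed
  qed
  moreover have "lead g < lead (f j)"
  proof -
    have "N k < N (lm j)" if k: "k \<in> Poly_Mapping.keys g" for k
    proof -
      have "Poly_Mapping.lookup (f i) (lm i) \<noteq> 0" using lm(1)[of i] by (simp add: in_keys_iff)
      then have "Poly_Mapping.lookup g (lm j) = 0"
        unfolding g_def by (simp add: lookup_minus ij(2) lookup_mult_monomial c_def)
      then have "k \<noteq> lm j" using k by (auto simp: in_keys_iff)
      then have "N k \<noteq> N (lm j)" using N(1) by (simp add: inj_eq)
      moreover have "N k \<le> N (lm j)"
      proof (cases "k \<in> Poly_Mapping.keys (f j)")
        case False
        then have "Poly_Mapping.lookup (f i * monomial m) k \<noteq> 0"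
          using k unfolding g_def by (auto simp: in_keys_iff lookup_minus)
        then have "k \<in> Poly_Mapping.keys (f i * monomial m)" by (simp add: in_keys_iff)
        then obtain l where "l \<in> Poly_Mapping.keys (f i)" "k = l + m"
          using keys_mult[of "f i" "monomial m"] by auto
        then show ?thesis using lead_ge N ij(2) by simp
      qed (rule lead_ge)
      ultimately show ?thesis by simp
    qed
    then show ?thesis
      unfolding lm(2)[symmetric] lead_def[of g] using keys_ne[OF \<open>new (deg j) g\<close>] by simp
  qed
  ultimately show False using least by (meson leD)
qed

section \<open>Standard bases as indexed families\<close>

text \<open>
  Over a finite field the product of all \<open>X - a\<close>, plus one, has no root.
\<close>

lemma infinite_alg_closed: "infinite (UNIV :: 'k::alg_closed_field set)"
proof
  assume fin: "finite (UNIV :: 'k set)"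
  define p where "p = (\<Prod>a\<in>(UNIV :: 'k set). [:- a, 1:])"
  have "degree p = (\<Sum>a\<in>(UNIV :: 'k set). degree [:- a, 1:])"
    unfolding p_def by (rule degree_prod_sum_eq) simp
  then have "degree p = card (UNIV :: 'k set)" by simp
  then have deg: "degree p > 0" using fin by (simp add: card_gt_0_iff)
  then have "degree (p + 1) > 0" using degree_add_eq_left[of 1 p] by simp
  then obtain x where "poly (p + 1) x = 0" using alg_closed_imp_poly_has_root by blast
  moreover have "poly p x = 0"
    unfolding p_def poly_prod using fin by (intro prod_zero) auto
  ultimately show False by simp
qed

text \<open>
  A standard basis presented as a family with index set fixed by \<open>I\<close>: the entries \<open>g d i\<close> with \<open>i < num_gens I d\<close>
  are its elements of degree \<open>d\<close>. Fixing the index set makes it possible to interpolate between two bases.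
\<close>

definition indexed_basis :: "('v::finite, 'k::field) mpol set \<Rightarrow> (nat \<Rightarrow> nat \<Rightarrow> ('v, 'k) mpol) \<Rightarrow> bool"
  where "indexed_basis I g \<longleftrightarrow> (\<forall>d. piece_basis I d (g d ` {..<num_gens I d}))"

definition others ::
    "('v::finite, 'k::field) mpol set \<Rightarrow> (nat \<Rightarrow> nat \<Rightarrow> ('v, 'k) mpol) \<Rightarrow> nat \<Rightarrow> nat \<Rightarrow> ('v, 'k) mpol set"
  where "others I g d i = {g e j | e j. j < num_gens I e \<and> (e, j) \<noteq> (d, i)}"

definition redundant ::
    "('v::finite, 'k::field) mpol set \<Rightarrow> (nat \<Rightarrow> nat \<Rightarrow> ('v, 'k) mpol) \<Rightarrow> nat \<Rightarrow> nat \<Rightarrow> bool"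
  where "redundant I g d i \<longleftrightarrow> g d i \<in> sat (ideal_of (others I g d i))"

lemma indexed_basisD:
  assumes "indexed_basis I g" "i < num_gens I d"
  shows "g d i \<in> I" "g d i \<in> forms d" "g d i \<noteq> 0"
proof -
  have pb: "piece_basis I d (g d ` {..<num_gens I d})"
    using assms(1) unfolding indexed_basis_def by simp
  have mem: "g d i \<in> g d ` {..<num_gens I d}" using assms(2) by simp
  show "g d i \<in> I" "g d i \<in> forms d" using piece_basis_subset[OF pb] mem by auto
  show "g d i \<noteq> 0" using zero_notin_piece_basis[OF pb] mem by metis
qed

lemma indexed_basis_inj:
  assumes "is_ideal I" "indexed_basis I g"
  shows "inj_on (g d) {..<num_gens I d}"
  using piece_basis_card(2)[OF assms(1), of "g d ` {..<num_gens I d}" d] assms(2)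
  unfolding indexed_basis_def by (intro eq_card_imp_inj_on) auto

lemma indexed_basis_distinct:
  assumes id: "is_ideal I" and g: "indexed_basis I g"
    and ij: "i < num_gens I d" "j < num_gens I e" and eq: "g e j = g d i"
  shows "(e, j) = (d, i)"
proof -
  have "e = d"
    using forms_disjoint[of "g d i" e d] indexed_basisD[OF g ij(1)] indexed_basisD[OF g ij(2)] eq
    by simp
  then show ?thesis using indexed_basis_inj[OF id g, of d] ij eq by (simp add: inj_on_def)
qed

lemma others_eq:
  assumes "is_ideal I" "indexed_basis I g" "i < num_gens I d"
  shows "others I g d i = (\<Union>e. g e ` {..<num_gens I e}) - {g d i}"
  unfolding others_def using indexed_basis_distinct[OF assms] by fastforce

lemma others_subset_forms:
  assumes "indexed_basis I g"
  shows "others I g d i \<subseteq> (\<Union>e. forms e)"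
  unfolding others_def using indexed_basisD[OF assms] by blast

lemma indexed_basis_standard:
  assumes "homogeneous_ideal I" "indexed_basis I g"
  shows "\<exists>r. standard_basis I (\<Union>d. g d ` {..<num_gens I d}) r"
  using assms by (intro standard_basis_of_pieces) (simp_all add: indexed_basis_def)

lemma num_essential_indexed:
  assumes id: "is_ideal I" and g: "indexed_basis I g"
  shows "num_essential (\<Union>d. g d ` {..<num_gens I d}) d
    = card {i. i < num_gens I d \<and> \<not> redundant I g d i}"
proof -
  let ?B = "\<Union>d. g d ` {..<num_gens I d}"
  have "?B \<inter> forms d = g d ` {..<num_gens I d}"
    using g Union_pieces_Int_forms[of "\<lambda>d. g d ` {..<num_gens I d}"]
    unfolding indexed_basis_def by blast
  then have "{f \<in> forms d. essential ?B f} = g d ` {i. i < num_gens I d \<and> \<not> redundant I g d i}"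
    unfolding essential_in_degree redundant_def using others_eq[OF id g, of _ d] by auto
  moreover have "inj_on (g d) {i. i < num_gens I d \<and> \<not> redundant I g d i}"
    using indexed_basis_inj[OF id g, of d] by (rule inj_on_subset) auto
  ultimately show ?thesis unfolding num_essential_def by (simp add: card_image)
qed

lemma standard_basis_indexed:
  assumes id: "is_ideal I" and sb: "standard_basis I B r"
  shows "\<exists>g. indexed_basis I g \<and> B = (\<Union>d. g d ` {..<num_gens I d})"
proof -
  have "\<exists>h. h ` {..<num_gens I d} = B \<inter> forms d" for d
  proof -
    note * = piece_basis_card[OF id standard_basis_piece[OF sb, of d]]
    show ?thesis
      using ex_bij_betw_nat_finite[OF *(1)] *(2) by (metis atLeast0LessThan bij_betw_imp_surj_on)
  qed
  then obtain g where g: "\<And>d. g d ` {..<num_gens I d} = B \<inter> forms d" by metis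
  then have "indexed_basis I g"
    unfolding indexed_basis_def using standard_basis_piece[OF sb] by simp
  moreover have "B = (\<Union>d. g d ` {..<num_gens I d})"
    unfolding g using sb unfolding standard_basis_def by blast
  ultimately show ?thesis by blast
qed

text \<open>
  Indices rather than the products themselves, so that the same set serves all indexed bases and the products can
  move along a line of bases.
\<close>

definition other_multiples ::
    "('v::finite, 'k::field) mpol set \<Rightarrow> nat \<Rightarrow> nat \<Rightarrow> nat \<Rightarrow> (('v \<Rightarrow>\<^sub>0 nat) \<times> nat \<times> nat) set"
  where "other_multiples I d i n =
    {(m, e, j). mon_deg m + e = n \<and> j < num_gens I e \<and> (e, j) \<noteq> (d, i)}"

lemma finite_other_multiples: "finite (other_multiples I d i n)"
proof (rule finite_subset)
  show "other_multiples I d i n \<subseteq> {m. mon_deg m \<le> n} \<times> (SIGMA e:{..n}. {..<num_gens I e})"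
    unfolding other_multiples_def by auto
  show "finite ({m :: 'a \<Rightarrow>\<^sub>0 nat. mon_deg m \<le> n} \<times> (SIGMA e:{..n}. {..<num_gens I e}))"
    using finite_mon_deg_le by blast
qed

lemma ideal_of_others_piece:
  assumes g: "indexed_basis I g" and x: "x \<in> forms n"
  shows "x \<in> ideal_of (others I g d i) \<longleftrightarrow>
    x \<in> kspan ((\<lambda>(m, e, j). monomial m * g e j) ` other_multiples I d i n)" (is "_ \<longleftrightarrow> x \<in> kspan ?M")
proof
  assume "x \<in> ideal_of (others I g d i)"
  then have "hom_component n x \<in> kspan {monomial m * h | m h. h \<in> others I g d i \<and>
      (\<exists>e. h \<in> forms e \<and> mon_deg m + e = n)}"
    using others_subset_forms[OF g] hom_component_ideal_in_span by blast
  also have "\<dots> \<subseteq> kspan ?M"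
  proof (intro vs.span_mono subsetI)
    fix y assume "y \<in> {monomial m * h | m h. h \<in> others I g d i \<and>
      (\<exists>e. h \<in> forms e \<and> mon_deg m + e = n)}"
    then obtain m e j e' where y: "y = monomial m * g e j" "j < num_gens I e" "(e, j) \<noteq> (d, i)"
      "g e j \<in> forms e'" "mon_deg m + e' = n"
      unfolding others_def by blast
    have "e' = e"
      using forms_disjoint[OF y(4)] indexed_basisD[OF g y(2)] by blast
    then have "(m, e, j) \<in> other_multiples I d i n" using y unfolding other_multiples_def by simp
    then show "y \<in> ?M" using y(1) by (intro image_eqI[of _ _ "(m, e, j)"]) auto
  qed
  finally show "x \<in> kspan ?M" using hom_component_of_form[OF x, of n] by simp
next
  assume x: "x \<in> kspan ?M"
  have "monomial m * g e j \<in> ideal_of (others I g d i)" if "(m, e, j) \<in> other_multiples I d i n"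
    for m e j
  proof -
    have "g e j \<in> others I g d i"
      using that unfolding other_multiples_def others_def by blast
    then show ?thesis by (intro ideal.span_scale ideal.span_base)
  qed
  then have "?M \<subseteq> ideal_of (others I g d i)" by auto
  then show "x \<in> ideal_of (others I g d i)"
    using x vs.span_minimal[OF _ subspace_ideal[OF ideal.subspace_span]] by blast
qed

text \<open>
  Let \<open>H\<close> be the ideal of the other elements. As \<open>I = H + (g d i)\<close>, the forms of degree \<open>t\<close> multiply \<open>g d i\<close> into
  \<open>H\<close> exactly when \<open>I\<close> and \<open>H\<close> agree in degree \<open>d + t\<close>.
\<close>

lemma redundant_iff_spanning:
  assumes I: "homogeneous_ideal I" and g: "indexed_basis I g" and i: "i < num_gens I d"
  shows "redundant I g d i \<longleftrightarrow> (\<exists>t. I \<inter> forms (d + t)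
    \<subseteq> kspan ((\<lambda>(m, e, j). monomial m * g e j) ` other_multiples I d i (d + t)))"
proof -
  note id = homogeneous_ideal_is_ideal[OF I]
  let ?H = "ideal_of (others I g d i)"
  have "insert (g d i) (others I g d i) = (\<Union>e. g e ` {..<num_gens I e})"
    unfolding others_eq[OF id g i] using i by blast
  then have gen: "ideal_of (insert (g d i) (others I g d i)) = I"
    using piece_bases_generate[OF I, of "\<lambda>e. g e ` {..<num_gens I e}"] g
    unfolding indexed_basis_def by simp
  have "(\<forall>a\<in>forms t. g d i * a \<in> ?H) \<longleftrightarrow> I \<inter> forms (d + t) \<subseteq> ?H" for t
  proof
    assume L: "\<forall>a\<in>forms t. g d i * a \<in> ?H"
    show "I \<inter> forms (d + t) \<subseteq> ?H"
    proof
      fix x assume x: "x \<in> I \<inter> forms (d + t)"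
      obtain a where "a \<in> forms (d + t - d)" "x - a * g d i \<in> ?H"
        using ideal_of_insert_form[OF others_subset_forms[OF g] indexed_basisD(2)[OF g i], of x _ i "d + t"]
          x gen by auto
      then have "x - g d i * a \<in> ?H" "g d i * a \<in> ?H" using L by (simp_all add: mult.commute)
      then show "x \<in> ?H" using ideal.span_add by fastforce
    qed
  next
    assume "I \<inter> forms (d + t) \<subseteq> ?H"
    then show "\<forall>a\<in>forms t. g d i * a \<in> ?H"
      using ideal_mult(1)[OF id indexed_basisD(1)[OF g i]] forms_mult[OF indexed_basisD(2)[OF g i]]
      by blast
  qed
  then have "redundant I g d i \<longleftrightarrow> (\<exists>t. I \<inter> forms (d + t) \<subseteq> ?H)"
    unfolding redundant_def sat_iff_forms[OF ideal.subspace_span] by simp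
  also have "\<dots> \<longleftrightarrow> (\<exists>t. I \<inter> forms (d + t)
    \<subseteq> kspan ((\<lambda>(m, e, j). monomial m * g e j) ` other_multiples I d i (d + t)))"
    using ideal_of_others_piece[OF g] by blast
  finally show ?thesis .
qed

section \<open>A standard basis with the fewest essential elements in every degree\<close>

definition pencil :: "(nat \<Rightarrow> nat \<Rightarrow> ('v, 'k::field) mpol) \<Rightarrow> (nat \<Rightarrow> nat \<Rightarrow> ('v, 'k) mpol) \<Rightarrow> 'k
    \<Rightarrow> nat \<Rightarrow> nat \<Rightarrow> ('v, 'k) mpol"
  where "pencil g g' c d i = g d i + kscale c (g' d i - g d i)"

lemma pencil_swap: "pencil g' g c = pencil g g' (1 - c)"
proof (intro ext)
  fix d i
  have "pencil g g' (1 - c) d i = g d i + ((g' d i - g d i) - kscale c (g' d i - g d i))"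
    by (simp add: pencil_def vs.scale_left_diff_distrib)
  also have "\<dots> = pencil g' g c d i"
    by (simp add: pencil_def vs.scale_right_diff_distrib)
  finally show "pencil g' g c d i = pencil g g' (1 - c) d i" ..
qed

text \<open>
  The spanning vectors are the entries of degree \<open>d\<close>, which move with \<open>c\<close>, together with a basis of \<open>from_below I d\<close>,
  which does not; the sum type keeps the two kinds apart.
\<close>

lemma finite_bad_piece:
  assumes id: "is_ideal I" and g: "indexed_basis I g" and g': "indexed_basis I g'"
  shows "finite {c. \<not> piece_basis I d (pencil g g' c d ` {..<num_gens I d})}"
proof -
  let ?V = "I \<inter> forms d" and ?W = "from_below I d" and ?r = "num_gens I d"
  note sV = subspace_piece[OF id, of d] and sW = subspace_from_below[of I d]
  have pb: "piece_basis I d (g d ` {..<?r})" using g unfolding indexed_basis_def by simp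
  have fin: "finite (monomial ` {m. mon_deg m \<le> d} :: ('a, 'b) mpol set)"
    using finite_mon_deg_le by blast
  have sub: "?V \<subseteq> vs.span (monomial ` {m. mon_deg m \<le> d})"
    using forms_subset_span_monomials by blast
  obtain C where C: "C \<subseteq> ?W" "vs.independent C" "?W \<subseteq> vs.span C"
    by (rule vs.maximal_independent_subset)
  have sC: "vs.span C = ?W" using C(1,3) sW by (rule vs.span_subspace)
  have finC: "finite C"
    using vs.independent_span_bound[OF fin C(2)] C(1) from_below_subset[OF id] sub
    by (meson order_trans)
  define J where "J = Inl ` {..<?r} \<union> Inr ` C"
  define u where "u = case_sum (g d) (\<lambda>x. x)"
  define w where "w = case_sum (\<lambda>i. g' d i - g d i) (\<lambda>_ :: ('a, 'b) mpol. 0)"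
  have img: "(\<lambda>j. u j + kscale c (w j)) ` J = pencil g g' c d ` {..<?r} \<union> C" for c
    unfolding J_def u_def w_def pencil_def image_Un image_image by simp
  have gV: "g d i \<in> ?V" "g' d i \<in> ?V" if "i < ?r" for i
    using indexed_basisD[OF g that] indexed_basisD[OF g' that] by auto
  have "finite {c. \<not> ?V \<subseteq> vs.span ((\<lambda>j. u j + kscale c (w j)) ` J)}"
  proof (rule vs.finite_nonspanning_pencil[OF _ sV])
    show "finite J" unfolding J_def using finC by simp
    show "u j \<in> ?V" if "j \<in> J" for j
      using that gV order_trans[OF C(1) from_below_subset[OF id]] unfolding J_def u_def by auto
    show "w j \<in> ?V" if "j \<in> J" for j
      using that gV vs.subspace_diff[OF sV] vs.subspace_0[OF sV] unfolding J_def w_def by auto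
    have "u ` J = g d ` {..<?r} \<union> C"
      unfolding J_def u_def image_Un image_image by simp
    then show "?V \<subseteq> vs.span (u ` J)"
      using pb unfolding quotient_basis_iff[OF C(2) sC sV] by simp
  qed
  moreover have "piece_basis I d (pencil g g' c d ` {..<?r})"
    if span: "?V \<subseteq> vs.span ((\<lambda>j. u j + kscale c (w j)) ` J)" for c
  proof (rule quotient_basis_spanningI[OF sW sV from_below_subset[OF id] fin sub])
    show "pencil g g' c d i \<in> ?V" if "i < ?r" for i
      unfolding pencil_def using gV[OF that]
      by (intro vs.subspace_add[OF sV] vs.subspace_scale[OF sV] vs.subspace_diff[OF sV])
    show "?V \<subseteq> vs.span (pencil g g' c d ` {..<?r} \<union> ?W)"
      using span vs.span_mono[of "pencil g g' c d ` {..<?r} \<union> C" "pencil g g' c d ` {..<?r} \<union> ?W"] C(1)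
      unfolding img by blast
    show "?r + vs.dim ?W = vs.dim ?V" by (rule piece_basis_card(3)[OF id pb])
  qed
  ultimately show ?thesis
    by (elim finite_subset[rotated]) blast
qed

lemma finite_bad_pencil:
  assumes id: "is_ideal I" and g: "indexed_basis I g" and g': "indexed_basis I g'"
  shows "finite {c. \<not> indexed_basis I (pencil g g' c)}"
proof -
  obtain n where n: "\<And>d. d \<ge> n \<Longrightarrow> from_below I d = I \<inter> forms d"
    using eventually_from_below[OF id] by blast
  have zero: "num_gens I d = 0" if "d \<ge> n" for d
    unfolding num_gens_def n[OF that] by simp
  have "{c. \<not> indexed_basis I (pencil g g' c)}
      \<subseteq> (\<Union>d<n. {c. \<not> piece_basis I d (pencil g g' c d ` {..<num_gens I d})})"
  proof
    fix c assume "c \<in> {c. \<not> indexed_basis I (pencil g g' c)}"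
    then obtain d where d: "\<not> piece_basis I d (pencil g g' c d ` {..<num_gens I d})"
      unfolding indexed_basis_def by blast
    have "piece_basis I d (g d ` {..<num_gens I d})" using g unfolding indexed_basis_def by simp
    then have "d < n" using d zero[of d] by (cases "d < n") auto
    then show "c \<in> (\<Union>d<n. {c. \<not> piece_basis I d (pencil g g' c d ` {..<num_gens I d})})"
      using d by blast
  qed
  then show ?thesis
    by (rule finite_subset) (use finite_bad_piece[OF assms] in blast)
qed

lemma finite_bad_redundant:
  assumes I: "homogeneous_ideal I" and g: "indexed_basis I g" and g': "indexed_basis I g'"
    and i: "i < num_gens I d" and red: "redundant I g d i"
  shows "finite {c. indexed_basis I (pencil g g' c) \<and> \<not> redundant I (pencil g g' c) d i}"
proof -
  note id = homogeneous_ideal_is_ideal[OF I]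
  obtain t where t: "I \<inter> forms (d + t)
      \<subseteq> kspan ((\<lambda>(m, e, j). monomial m * g e j) ` other_multiples I d i (d + t))"
    using red redundant_iff_spanning[OF I g i] by blast
  let ?V = "I \<inter> forms (d + t)" and ?J = "other_multiples I d i (d + t)"
  note sV = subspace_piece[OF id, of "d + t"]
  define u where "u = (\<lambda>(m, e, j). monomial m * g e j)"
  define w where "w = (\<lambda>(m, e, j). monomial m * (g' e j - g e j))"
  have V: "monomial m * h \<in> ?V" if "(m, e, j) \<in> ?J" "h \<in> I \<inter> forms e" for m e j h
    using that forms_mult[OF monomial_in_forms[of m], of h e] ideal_mult(2)[OF id]
    unfolding other_multiples_def by auto
  have gV: "g e j \<in> I \<inter> forms e" "g' e j \<in> I \<inter> forms e" if "(m, e, j) \<in> ?J" for m e j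
    using that indexed_basisD[OF g] indexed_basisD[OF g'] unfolding other_multiples_def by auto
  have pencil: "(\<lambda>j. u j + kscale c (w j)) = (\<lambda>(m, e, j). monomial m * pencil g g' c e j)" for c
    unfolding u_def w_def pencil_def by (auto simp: distrib_left kscale_mult_right)
  have "finite {c. \<not> ?V \<subseteq> vs.span ((\<lambda>j. u j + kscale c (w j)) ` ?J)}"
  proof (rule vs.finite_nonspanning_pencil[OF finite_other_multiples sV])
    show "u j \<in> ?V" if "j \<in> ?J" for j
      using that V gV unfolding u_def by (cases j) auto
    show "w j \<in> ?V" if "j \<in> ?J" for j
    proof (cases j)
      case (fields m e k)
      then show ?thesis
        using V[of m e k "g' e k - g e k"] that gV[of m e k]
          vs.subspace_diff[OF subspace_piece[OF id]] unfolding w_def by auto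
    qed
    show "?V \<subseteq> vs.span (u ` ?J)" using t unfolding u_def .
  qed
  then show ?thesis
    unfolding pencil
    by (rule finite_subset[rotated]) (use redundant_iff_spanning[OF I _ i] in blast)
qed

text \<open>
  Induction on \<open>X\<close>: on the line joining a family that is good for \<open>X\<close> to one that is good for the new index, all but
  finitely many parameters give an indexed basis good for both.
\<close>

lemma simultaneously_redundant:
  fixes I :: "('v::finite, 'k::field) mpol set"
  assumes inf: "infinite (UNIV :: 'k set)" and I: "homogeneous_ideal I" and "finite X"
    and "\<And>d i. (d, i) \<in> X \<Longrightarrow> i < num_gens I d \<and> (\<exists>g. indexed_basis I g \<and> redundant I g d i)"
  shows "\<exists>g. indexed_basis I g \<and> (\<forall>(d, i)\<in>X. redundant I g d i)"
  using assms(3,4)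
proof (induction X rule: finite_induct)
  case empty
  obtain B r where "standard_basis I B r" using standard_basis_exists[OF I] by blast
  then show ?case using standard_basis_indexed[OF homogeneous_ideal_is_ideal[OF I]] by blast
next
  case (insert x X)
  note id = homogeneous_ideal_is_ideal[OF I]
  obtain d i where x: "x = (d, i)" by (cases x)
  obtain g where g: "indexed_basis I g" "\<And>e j. (e, j) \<in> X \<Longrightarrow> redundant I g e j"
    using insert by blast
  obtain g' where i: "i < num_gens I d" and g': "indexed_basis I g'" "redundant I g' d i"
    using insert.prems[of d i] x by blast
  let ?bad = "\<lambda>e j. {c. indexed_basis I (pencil g g' c) \<and> \<not> redundant I (pencil g g' c) e j}"
  have "finite (?bad e j)" if "(e, j) \<in> X" for e j
    using that insert.prems g g'(1) by (intro finite_bad_redundant[OF I]) auto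
  then have "finite (\<Union>(e, j)\<in>X. ?bad e j)" using insert.hyps(1) by auto
  moreover have "finite (?bad d i)"
  proof -
    \<comment> \<open>The new index is redundant at the far end of the line, so the line is traversed backwards.\<close>
    let ?bad' = "{c. indexed_basis I (pencil g' g c) \<and> \<not> redundant I (pencil g' g c) d i}"
    have "finite ((\<lambda>c. 1 - c) ` ?bad')"
      using finite_bad_redundant[OF I g'(1) g(1) i g'(2)] by (rule finite_imageI)
    moreover have "?bad d i \<subseteq> (\<lambda>c. 1 - c) ` ?bad'"
    proof
      fix c assume "c \<in> ?bad d i"
      then show "c \<in> (\<lambda>c. 1 - c) ` ?bad'"
        by (intro image_eqI[of _ _ "1 - c"]) (simp_all add: pencil_swap[of g' g])
    qed
    ultimately show ?thesis by (rule finite_subset[rotated])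
  qed
  moreover have "finite {c. \<not> indexed_basis I (pencil g g' c)}"
    using finite_bad_pencil[OF id g(1) g'(1)] .
  ultimately have "finite ({c. \<not> indexed_basis I (pencil g g' c)} \<union> ?bad d i \<union> (\<Union>(e, j)\<in>X. ?bad e j))"
    by blast
  then obtain c where "c \<notin> {c. \<not> indexed_basis I (pencil g g' c)} \<union> ?bad d i \<union> (\<Union>(e, j)\<in>X. ?bad e j)"
    using ex_new_if_finite[OF inf] by meson
  then show ?case using x by (intro exI[of _ "pencil g g' c"]) auto
qed

text \<open>
  Redundancy of all the indices that are redundant in some basis minimal in their own degree leaves at most
  \<open>mu_e I d\<close> essential elements in each degree.
\<close>

lemma basis_min_exists:
  fixes I :: "('v::finite, 'k::field) mpol set"
  assumes inf: "infinite (UNIV :: 'k set)" and I: "homogeneous_ideal I"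
  shows "\<exists>B r. standard_basis I B r \<and> (\<forall>d. num_essential B d = mu_e I d)"
proof -
  note id = homogeneous_ideal_is_ideal[OF I]
  have "\<exists>g. indexed_basis I g \<and> card {i. i < num_gens I d \<and> \<not> redundant I g d i} = mu_e I d" for d
  proof -
    obtain B r where B: "standard_basis I B r" "num_essential B d = mu_e I d"
      using mu_e_attained[OF I] by blast
    obtain g where "indexed_basis I g" "B = (\<Union>d. g d ` {..<num_gens I d})"
      using standard_basis_indexed[OF id B(1)] by blast
    then show ?thesis using num_essential_indexed[OF id, of g d] B(2) by auto
  qed
  then obtain gs where gs: "\<And>d. indexed_basis I (gs d)"
    "\<And>d. card {i. i < num_gens I d \<and> \<not> redundant I (gs d) d i} = mu_e I d"
    by metis
  define X where "X = {(d, i). i < num_gens I d \<and> redundant I (gs d) d i}"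
  obtain n where n: "\<And>d. d \<ge> n \<Longrightarrow> from_below I d = I \<inter> forms d"
    using eventually_from_below[OF id] by blast
  have "d < n" if "i < num_gens I d" for d i
    using that n[of d] unfolding num_gens_def by (cases "d < n") auto
  then have "X \<subseteq> (SIGMA d:{..<n}. {..<num_gens I d})" unfolding X_def by auto
  then have "finite X" by (rule finite_subset) auto
  then obtain g where g: "indexed_basis I g" "\<And>d i. (d, i) \<in> X \<Longrightarrow> redundant I g d i"
    using simultaneously_redundant[OF inf I, of X] gs(1) unfolding X_def by blast
  let ?B = "\<Union>d. g d ` {..<num_gens I d}"
  obtain r where r: "standard_basis I ?B r" using indexed_basis_standard[OF I g(1)] by blast
  have "num_essential ?B d = mu_e I d" for d
  proof (rule order_antisym)
    have "num_essential ?B d = card {i. i < num_gens I d \<and> \<not> redundant I g d i}"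
      by (rule num_essential_indexed[OF id g(1)])
    also have "\<dots> \<le> card {i. i < num_gens I d \<and> \<not> redundant I (gs d) d i}"
      using g(2) unfolding X_def by (intro card_mono) auto
    finally show "num_essential ?B d \<le> mu_e I d" using gs(2) by simp
    show "mu_e I d \<le> num_essential ?B d" using r by (rule mu_e_le_num_essential)
  qed
  then show ?thesis using r by blast
qed

theorem proposition5p2:
  fixes I :: "('v::finite, 'k::alg_closed_field) mpol set"
  assumes "homogeneous_ideal I"
    and "sat I \<subset> max_ideal"
  shows "(\<exists>B r. standard_basis I B r \<and> (\<forall>d. num_essential B d = nu_e I d)) \<and>
         (\<exists>B r. standard_basis I B r \<and> (\<forall>d. num_essential B d = mu_e I d))"
  using basis_Max_exists[OF assms(1)] basis_min_exists[OF infinite_alg_closed assms(1)] by blast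

end
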